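(* Let $\mathbb{K}=\mathbb{R}$ or $\mathbb{C}$ and let $\{\sigma_n\}_{n\ge 0}$ be a sequence of numbers in $\mathbb{K}$. (i) The Rademacher space $\{x\in\mathbb{K}^{\mathbb{N}_0}: x_n\in\{\sigma_n,-\sigma_n\}\text{ for all }n\}$ admits detection if and only if $\sum_n|\sigma_n|^4=\infty$, while it does not admit recovery unless all the $\sigma_n$ are zero. (ii) There exist absolute constants $0<a<b<\infty$ such that, whenever the absolute values $\{|\sigma_n|\}$ are non-increasing, the following holds: if $$\limsup_{k\to\infty}\frac{1}{\log k}\sum_{n=0}^{k-1}|\sigma_n|^2$$ is larger than $b$ then the Walsh space admits recovery, while if this limit superior is smaller than $a$ then the Walsh space does not admit detection.
   Context: Here $\mathbb{N}_0=\{0,1,2,\ldots\}$. The Walsh space associated with $\{\sigma_n\}$ is the set of all signals $x(\varepsilon)\in\mathbb{K}^{\mathbb{N}_0}$, indexed by sequences $\varepsilon=(\varepsilon_j)_{j\ge0}$ with $\varepsilon_j\in\{-1,1\}$, defined by $x_n(\varepsilon)=\sigma_n\prod_{j:\,n_j\ne0}\varepsilon_j$, where $n=\sum_{j\ge0}n_j2^j$, $n_j\in\{0,1\}$, is the binary expansion of $n$. Noise: $\xi=(\xi_n)_{n\ge0}$ is a sequence of independent standard Gaussian random variables: if $\mathbb{K}=\mathbb{R}$, $\xi_n\sim N(0,1)$; if $\mathbb{K}=\mathbb{C}$, the real and imaginary parts of $\xi_n$ are independent and each distributed as $N(0,1)$. A set $\mathcal{X}\subset\mathbb{K}^{\mathbb{N}_0}$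 admits recovery if there is a Borel measurable map $T:\mathbb{K}^{\mathbb{N}_0}\to\mathbb{K}^{\mathbb{N}_0}$ such that for each $x\in\mathcal{X}$, $T(x+\xi)=x$ almost surely. It admits detection if there is a Borel measurable map $T:\mathbb{K}^{\mathbb{N}_0}\to\{0,1\}$ such that $T(\xi)=0$ almost surely and, for every $x\in\mathcal{X}$, $T(x+\xi)=1$ almost surely. (Borel structure is that of the product topology.) The constants $a,b$ in (ii) do not depend on $\{\sigma_n\}$. *)

theory Defs
  imports "HOL-Probability.Probability"
begin

definition std_gaussian_real :: "real measure" where
  "std_gaussian_real = density lborel (\<lambda>x. ennreal (std_normal_density x))"

(* Real and imaginary parts are independent N(0,1), so a standard complex Gaussian has
   second absolute moment 2, not 1. *)
definition std_gaussian_complex :: "complex measure" where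
  "std_gaussian_complex =
     distr (std_gaussian_real \<Otimes>\<^sub>M std_gaussian_real) borel (\<lambda>(u, v). Complex u v)"

(* The law of an i.i.d. sequence with marginal law G. The notions below depend on the noise
   only through its law, so the noise is taken to be the coordinate process of this measure
   (see AE_noise_iff). *)
definition noise :: "'a measure \<Rightarrow> (nat \<Rightarrow> 'a) measure" where
  "noise G = PiM UNIV (\<lambda>_. G)"

(* On the type nat => 'a, borel is the Borel sigma-algebra of the product topology. *)
definition admits_recovery ::
    "'a::real_normed_field measure \<Rightarrow> (nat \<Rightarrow> 'a) set \<Rightarrow> bool" where
  "admits_recovery G X \<longleftrightarrow>
     (\<exists>T :: (nat \<Rightarrow> 'a) \<Rightarrow> (nat \<Rightarrow> 'a). T \<in> borel \<rightarrow>\<^sub>M borel \<and>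
        (\<forall>x\<in>X. AE \<xi> in noise G. T (\<lambda>n. x n + \<xi> n) = x))"

definition admits_detection ::
    "'a::real_normed_field measure \<Rightarrow> (nat \<Rightarrow> 'a) set \<Rightarrow> bool" where
  "admits_detection G X \<longleftrightarrow>
     (\<exists>T :: (nat \<Rightarrow> 'a) \<Rightarrow> nat. T \<in> borel \<rightarrow>\<^sub>M count_space {0, 1} \<and>
        (AE \<xi> in noise G. T \<xi> = 0) \<and>
        (\<forall>x\<in>X. AE \<xi> in noise G. T (\<lambda>n. x n + \<xi> n) = 1))"

definition rademacher_space :: "(nat \<Rightarrow> 'a::real_normed_field) \<Rightarrow> (nat \<Rightarrow> 'a) set" where
  "rademacher_space \<sigma> = {x. \<forall>n. x n \<in> {\<sigma> n, - \<sigma> n}}"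

definition walsh_signal ::
    "(nat \<Rightarrow> 'a::real_normed_field) \<Rightarrow> (nat \<Rightarrow> 'a) \<Rightarrow> nat \<Rightarrow> 'a" where
  "walsh_signal \<sigma> \<epsilon> n = \<sigma> n * (\<Prod>j | bit n j. \<epsilon> j)"

definition walsh_space :: "(nat \<Rightarrow> 'a::real_normed_field) \<Rightarrow> (nat \<Rightarrow> 'a) set" where
  "walsh_space \<sigma> = {walsh_signal \<sigma> \<epsilon> | \<epsilon>. \<forall>j. \<epsilon> j \<in> {-1, 1}}"

(* Values in ereal, so that the limit superior may be infinite. The terms k = 0 and k = 1 are
   meaningless (ln k = 0 there) and do not affect it. *)
definition log_energy :: "(nat \<Rightarrow> 'a::real_normed_field) \<Rightarrow> ereal" where
  "log_energy \<sigma> =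
     limsup (\<lambda>k. ereal (1 / ln (real k) * (\<Sum>n<k. (norm (\<sigma> n))\<^sup>2)))"

lemma sets_std_gaussian [measurable_cong, simp]:
  "sets std_gaussian_real = sets borel" "sets std_gaussian_complex = sets borel"
  by (simp_all add: std_gaussian_real_def std_gaussian_complex_def)

lemma sets_noise:
  fixes G :: "'a::{second_countable_topology} measure"
  assumes "sets G = sets borel"
  shows "sets (noise G) = sets borel"
proof -
  have "sets (noise G) = sets (PiM UNIV (\<lambda>_::nat. (borel :: 'a measure)))"
    unfolding noise_def by (rule sets_PiM_cong) (use assms in auto)
  then show ?thesis by (simp add: sets_PiM_equal_borel)
qed

lemma finite_bits: "finite {j. bit (n :: nat) j}"
proof -
  have "{j. bit n j} \<subseteq> {..<n}"
  proof
    fix j assume "j \<in> {j. bit n j}"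
    then have le: "2 ^ j \<le> n"
      by (metis bit_iff_odd div_less even_zero mem_Collect_eq not_le)
    show "j \<in> {..<n}" using less_le_trans[OF less_exp le] by simp
  qed
  then show ?thesis by (rule finite_subset) simp
qed

lemma AE_noise_iff:
  fixes \<xi> :: "nat \<Rightarrow> 'b \<Rightarrow> 'a::second_countable_topology"
  assumes "prob_space M" and G: "sets G = sets borel"
    and indep: "prob_space.indep_vars M (\<lambda>_. borel) \<xi> UNIV"
    and law: "\<And>n. distr M borel (\<xi> n) = G"
    and P: "{y. P y} \<in> sets borel"
  shows "(AE \<omega> in M. P (\<lambda>n. \<xi> n \<omega>)) \<longleftrightarrow> (AE y in noise G. P y)"
proof -
  interpret prob_space M by fact
  have rv: "\<And>n. random_variable borel (\<xi> n)" using indep by (auto simp: indep_vars_def)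
  have "distr M (PiM UNIV (\<lambda>_::nat. borel)) (\<lambda>\<omega>. \<lambda>n\<in>UNIV. \<xi> n \<omega>)
      = PiM UNIV (\<lambda>n. distr M borel (\<xi> n))"
    using indep rv by (subst (asm) indep_vars_iff_distr_eq_PiM) auto
  then have eq: "noise G = distr M (PiM UNIV (\<lambda>_::nat. borel)) (\<lambda>\<omega> n. \<xi> n \<omega>)"
    by (simp add: noise_def law restrict_UNIV)
  have m: "(\<lambda>\<omega> n. \<xi> n \<omega>) \<in> M \<rightarrow>\<^sub>M PiM UNIV (\<lambda>_::nat. borel)"
    using rv by (intro measurable_PiM_single') auto
  show ?thesis unfolding eq
    using P by (subst AE_distr_iff[OF m]) (auto simp: space_PiM sets_PiM_equal_borel)
qed

end

theory Submission
  imports Defs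
begin

text \<open>
Detection fails as soon as, for some prior on the signal set, the likelihood ratio of the mixture
against pure noise is bounded in $L^2$ along a sequence of finite-dimensional projections; for
Gaussian noise its second moment is the average of $\exp\langle x, x'\rangle$ over two independent
signals. For random signs this average is $\prod_n \cosh |\sigma_n|^2$. For Walsh signals
$\langle x, x'\rangle = \sum_n |\sigma_n|^2 w_n$ is a Walsh sum with monotone coefficients, and over
$n < 2^K$ it is at most $\sum_{n < 2^j} |\sigma_n|^2$, where $j$ is the first coordinate in which the
two sign sequences differ; this $j$ is geometrically distributed.

Conversely, the Rademacher space is detected by the even statistic
$\sum_n (e^{-|u_n|^2/2} - \cos\langle y_n, u_n\rangle)$ and Chebyshev's inequality, with $u_n$ a suitable
multiple of $\sigma_n$, and a Walsh signal is recovered by maximum likelihood among the $2^K$ sign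
patterns: the same bound on Walsh sums makes all competitors that differ in a fixed coordinate far
away. Recovery fails for the Rademacher space since flipping one sign changes the law of the
observation to an equivalent one.
\<close>

section \<open>Infinite product measures\<close>

text \<open>Redrawing coordinate \<open>m\<close> from its own law, independently of all others,
  leaves the product law unchanged. This Fubini step for one coordinate drives the inductions over
  finitely many coordinates below.\<close>

lemma nn_integral_PiM_update:
  fixes M :: "'i \<Rightarrow> 'b measure"
  assumes M: "\<And>i. prob_space (M i)" and f [measurable]: "f \<in> borel_measurable (PiM UNIV M)"
  shows "(\<integral>\<^sup>+w. f w \<partial>PiM UNIV M) = (\<integral>\<^sup>+w. \<integral>\<^sup>+y. f (w(m := y)) \<partial>M m \<partial>PiM UNIV M)"
proof -
  interpret Mm: prob_space "M m" by (rule M)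
  interpret P: prob_space "PiM UNIV M" by (intro prob_space_PiM M)
  interpret pair_sigma_finite "M m" "PiM UNIV M" ..
  have upd [measurable]: "(\<lambda>(y, w). w(m := y)) \<in> M m \<Otimes>\<^sub>M PiM UNIV M \<rightarrow>\<^sub>M PiM UNIV M"
  proof (rule measurable_PiM_single')
    show "(\<lambda>p. (case p of (y, w) \<Rightarrow> w(m := y)) i) \<in> M m \<Otimes>\<^sub>M PiM UNIV M \<rightarrow>\<^sub>M M i" for i
      by (cases "i = m") (auto simp: case_prod_beta)
  qed (auto simp: space_pair_measure space_PiM PiE_iff)
  have "PiM UNIV M = distr (M m \<Otimes>\<^sub>M PiM UNIV M) (PiM UNIV M) (\<lambda>(y, w). w(m := y))"
    using distr_pair_PiM_eq_PiM[of UNIV M m] M by simp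
  then have "(\<integral>\<^sup>+w. f w \<partial>PiM UNIV M)
      = (\<integral>\<^sup>+w. f w \<partial>distr (M m \<Otimes>\<^sub>M PiM UNIV M) (PiM UNIV M) (\<lambda>(y, w). w(m := y)))"
    by simp
  also have "\<dots> = (\<integral>\<^sup>+p. f ((snd p)(m := fst p)) \<partial>(M m \<Otimes>\<^sub>M PiM UNIV M))"
    by (subst nn_integral_distr) (auto simp: case_prod_beta)
  also have "\<dots> = (\<integral>\<^sup>+w. \<integral>\<^sup>+y. f (w(m := y)) \<partial>M m \<partial>PiM UNIV M)"
    using upd by (subst nn_integral_snd[symmetric]) (auto simp: case_prod_beta')
  finally show ?thesis .
qed

lemma nn_integral_PiM_prod:
  fixes M :: "'i \<Rightarrow> 'b measure" and f :: "'i \<Rightarrow> 'b \<Rightarrow> ennreal"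
  assumes M: "\<And>i. prob_space (M i)" and "finite J"
    and f [measurable]: "\<And>i. f i \<in> borel_measurable (M i)"
  shows "(\<integral>\<^sup>+w. (\<Prod>j\<in>J. f j (w j)) \<partial>PiM UNIV M) = (\<Prod>j\<in>J. \<integral>\<^sup>+y. f j y \<partial>M j)"
  using \<open>finite J\<close>
proof (induction J)
  case empty
  interpret P: prob_space "PiM UNIV M" by (intro prob_space_PiM M)
  show ?case by (simp add: P.emeasure_space_1)
next
  case (insert m J)
  have eq: "(\<Prod>j\<in>J. f j ((w(m := y)) j)) = (\<Prod>j\<in>J. f j (w j))" for w :: "'i \<Rightarrow> 'b" and y
    using insert by (intro prod.cong) auto
  have "(\<integral>\<^sup>+w. (\<Prod>j\<in>insert m J. f j (w j)) \<partial>PiM UNIV M)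
      = (\<integral>\<^sup>+w. \<integral>\<^sup>+y. f m y * (\<Prod>j\<in>J. f j (w j)) \<partial>M m \<partial>PiM UNIV M)"
    using insert by (subst nn_integral_PiM_update[OF M, where m = m]) (simp_all add: eq fun_upd_same del: fun_upd_apply)
  also have "\<dots> = (\<integral>\<^sup>+y. f m y \<partial>M m) * (\<integral>\<^sup>+w. (\<Prod>j\<in>J. f j (w j)) \<partial>PiM UNIV M)"
    by (simp add: nn_integral_multc nn_integral_cmult)
  finally show ?case using insert by simp
qed

text \<open>Redrawing the newest coordinate kills the cross term because that summand is centred, so
  second moments add. The nonnegative integral avoids tracking integrability on the product
  space.\<close>

lemma nn_integral_PiM_sum_power2:
  fixes M :: "'i \<Rightarrow> 'b measure" and h :: "'i \<Rightarrow> 'b \<Rightarrow> real"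
  assumes M: "\<And>i. prob_space (M i)" and "finite J"
    and int: "\<And>i. integrable (M i) (h i)" and sq: "\<And>i. integrable (M i) (\<lambda>y. (h i y)\<^sup>2)"
    and centred: "\<And>i. (\<integral>y. h i y \<partial>M i) = 0"
  shows "(\<integral>\<^sup>+w. ennreal ((\<Sum>j\<in>J. h j (w j))\<^sup>2) \<partial>PiM UNIV M)
    = ennreal (\<Sum>j\<in>J. \<integral>y. (h j y)\<^sup>2 \<partial>M j)"
  using \<open>finite J\<close>
proof (induction J)
  case (insert m J)
  interpret P: prob_space "PiM UNIV M" by (intro prob_space_PiM M)
  interpret Mm: prob_space "M m" by (rule M)
  note [measurable] = borel_measurable_integrable[OF int]
  have eq: "(\<Sum>j\<in>J. h j ((w(m := y)) j)) = (\<Sum>j\<in>J. h j (w j))" for w :: "'i \<Rightarrow> 'b" and y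
    using insert by (intro sum.cong) auto
  have inner: "(\<integral>\<^sup>+y. ennreal ((h m y + c)\<^sup>2) \<partial>M m) = ennreal ((\<integral>y. (h m y)\<^sup>2 \<partial>M m)) + ennreal (c\<^sup>2)"
    for c
  proof -
    have *: "(\<lambda>y. (h m y + c)\<^sup>2) = (\<lambda>y. (h m y)\<^sup>2 + (2 * c * h m y + c\<^sup>2))"
      by (auto simp: power2_eq_square algebra_simps)
    have "(\<integral>\<^sup>+y. ennreal ((h m y + c)\<^sup>2) \<partial>M m) = ennreal (\<integral>y. (h m y + c)\<^sup>2 \<partial>M m)"
      using int sq by (intro nn_integral_eq_integral) (auto simp: *)
    also have "(\<integral>y. (h m y + c)\<^sup>2 \<partial>M m) = (\<integral>y. (h m y)\<^sup>2 \<partial>M m) + c\<^sup>2"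
      unfolding * using int sq centred by (simp add: Mm.prob_space)
    finally show ?thesis by simp
  qed
  have "(\<integral>\<^sup>+w. ennreal ((\<Sum>j\<in>insert m J. h j (w j))\<^sup>2) \<partial>PiM UNIV M)
      = (\<integral>\<^sup>+w. \<integral>\<^sup>+y. ennreal ((h m y + (\<Sum>j\<in>J. h j (w j)))\<^sup>2) \<partial>M m \<partial>PiM UNIV M)"
    using insert by (subst nn_integral_PiM_update[OF M, where m = m]) (simp_all add: eq fun_upd_same del: fun_upd_apply)
  also have "\<dots> = ennreal (\<integral>y. (h m y)\<^sup>2 \<partial>M m) + (\<integral>\<^sup>+w. ennreal ((\<Sum>j\<in>J. h j (w j))\<^sup>2) \<partial>PiM UNIV M)"
    unfolding inner by (subst nn_integral_add) (simp_all add: P.emeasure_space_1)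
  finally show ?case
    using insert by (simp add: sum_nonneg)
qed simp

section \<open>Approximation of events by finite-dimensional cylinders\<close>

definition cylinder :: "nat \<Rightarrow> (nat \<Rightarrow> 'b) set \<Rightarrow> bool" where
  "cylinder k B \<longleftrightarrow> (\<forall>w w'. (\<forall>n<k. w n = w' n) \<longrightarrow> (w \<in> B \<longleftrightarrow> w' \<in> B))"

lemma cylinder_mono: "cylinder k B \<Longrightarrow> k \<le> l \<Longrightarrow> cylinder l B"
  unfolding cylinder_def by (meson less_le_trans)

lemma cylinder_Compl: "cylinder k B \<Longrightarrow> cylinder k (- B)"
  unfolding cylinder_def by blast

lemma cylinder_UN: "(\<And>i. i \<in> I \<Longrightarrow> cylinder k (B i)) \<Longrightarrow> cylinder k (\<Union>i\<in>I. B i)"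
  unfolding cylinder_def by blast

text \<open>The approximable events contain the one-coordinate generators and are closed under
  complements and countable unions. A single \<open>B\<close> has to serve both measures, since
  detection compares the noise law with a mixture of shifted laws on the same event.\<close>

lemma cylinder_approx:
  fixes P Q :: "(nat \<Rightarrow> 'b) measure"
  assumes "finite_measure P" "finite_measure Q"
    and P: "sets P = sets (PiM UNIV (\<lambda>_. M))" and Q: "sets Q = sets (PiM UNIV (\<lambda>_. M))"
    and sp: "space M = UNIV"
    and A: "A \<in> sets P" and e: "0 < (e::real)"
  shows "\<exists>k B. cylinder k B \<and> B \<in> sets P \<and> measure P (sym_diff A B) < e
    \<and> measure Q (sym_diff A B) < e"
proof -
  interpret P: finite_measure P by fact
  interpret Q: finite_measure Q by fact
  have PQ: "sets P = sets Q" by (simp add: P Q)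
  have spP: "space P = UNIV"
    using sets_eq_imp_space_eq[OF P] by (simp add: space_PiM sp)
  have gen: "sets P = sigma_sets UNIV {{f. f i \<in> X} | i X. X \<in> sets M}"
    unfolding P sets_PiM_single by (simp add: sp)
  have "A \<in> sigma_sets UNIV {{f. f i \<in> X} | i X. X \<in> sets M}" using A gen by simp
  then show ?thesis using e
  proof (induction arbitrary: e rule: sigma_sets.induct)
    case (Basic a)
    then obtain i X where iX: "a = {f. f i \<in> X}" "X \<in> sets M" by auto
    then have "cylinder (Suc i) a" by (auto simp: cylinder_def)
    moreover have "a \<in> sets P" unfolding gen using Basic by (blast intro: sigma_sets.Basic)
    ultimately show ?case using \<open>0 < e\<close> by (intro exI[of _ "Suc i"] exI[of _ a]) simp
  next
    case Empty
    then show ?case by (intro exI[of _ 0] exI[of _ "{}"]) (simp add: cylinder_def)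
  next
    case (Compl a)
    then obtain k B where B: "cylinder k B" "B \<in> sets P" "measure P (sym_diff a B) < e"
      "measure Q (sym_diff a B) < e" by blast
    have "- B \<in> sets P" using sets.compl_sets[OF B(2)] by (simp add: spP Compl_eq_Diff_UNIV)
    moreover have "sym_diff (UNIV - a) (- B) = sym_diff a B" by auto
    ultimately show ?case using B cylinder_Compl by (intro exI[of _ k] exI[of _ "- B"]) simp
  next
    case (Union a)
    have aP: "a i \<in> sets P" for i unfolding gen by (rule Union)
    \<comment> \<open>The errors of the pieces sum to at most \<open>e / 2\<close>; the other half
      pays for cutting the countable union down to its first \<open>N\<close> pieces.\<close>
    have "\<exists>k B. cylinder k B \<and> B \<in> sets P \<and> measure P (sym_diff (a i) B) < e / 2 * (1/2)^Suc i
      \<and> measure Q (sym_diff (a i) B) < e / 2 * (1/2)^Suc i" for i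
      using \<open>0 < e\<close> by (intro Union.IH) auto
    then obtain k B where B: "\<And>i. cylinder (k i) (B i)" "\<And>i. B i \<in> sets P"
      "\<And>i. measure P (sym_diff (a i) (B i)) < e / 2 * (1/2)^Suc i"
      "\<And>i. measure Q (sym_diff (a i) (B i)) < e / 2 * (1/2)^Suc i" by metis
    have tail: "\<exists>N. \<forall>n\<ge>N. measure R ((\<Union>i. a i) - (\<Union>i<n. a i)) < e / 2"
      if R: "finite_measure R" "sets R = sets P" for R
    proof -
      interpret R: finite_measure R by fact
      have "(\<lambda>n. measure R ((\<Union>i. a i) - (\<Union>i<n. a i)))
        \<longlonglongrightarrow> measure R (\<Inter>n. (\<Union>i. a i) - (\<Union>i<n. a i))"
        using aP R(2) by (intro R.finite_Lim_measure_decseq) (auto simp: decseq_def intro: less_le_trans)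
      moreover have "(\<Inter>n. (\<Union>i. a i) - (\<Union>i<n. a i)) = {}" by auto
      ultimately have "(\<lambda>n. measure R ((\<Union>i. a i) - (\<Union>i<n. a i))) \<longlonglongrightarrow> 0"
        by (metis measure_empty)
      from order_tendstoD(2)[OF this, of "e/2"] \<open>0 < e\<close>
      show ?thesis by (simp add: eventually_sequentially)
    qed
    obtain N1 where N1: "\<And>n. n \<ge> N1 \<Longrightarrow> measure P ((\<Union>i. a i) - (\<Union>i<n. a i)) < e / 2"
      using tail[OF \<open>finite_measure P\<close>] by auto
    obtain N2 where N2: "\<And>n. n \<ge> N2 \<Longrightarrow> measure Q ((\<Union>i. a i) - (\<Union>i<n. a i)) < e / 2"
      using tail[OF \<open>finite_measure Q\<close>] PQ by auto
    define N where "N = max N1 N2"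
    let ?B = "\<Union>i<N. B i"
    have fin: "measure R (sym_diff (\<Union>i. a i) ?B) < e"
      if R: "finite_measure R" "sets R = sets P"
        and small: "measure R ((\<Union>i. a i) - (\<Union>i<N. a i)) < e / 2"
        "\<And>i. measure R (sym_diff (a i) (B i)) < e / 2 * (1/2)^Suc i" for R
    proof -
      interpret R: finite_measure R by fact
      have m: "a i \<in> sets R" "B i \<in> sets R" for i using aP B(2) R(2) by auto
      have "measure R (sym_diff (\<Union>i. a i) ?B)
          \<le> measure R (((\<Union>i. a i) - (\<Union>i<N. a i)) \<union> (\<Union>i<N. sym_diff (a i) (B i)))"
        using m by (intro R.finite_measure_mono) auto
      also have "\<dots> \<le> measure R ((\<Union>i. a i) - (\<Union>i<N. a i)) + measure R (\<Union>i<N. sym_diff (a i) (B i))"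
        using m by (intro measure_Un_le) auto
      also have "measure R (\<Union>i<N. sym_diff (a i) (B i)) \<le> (\<Sum>i<N. measure R (sym_diff (a i) (B i)))"
        using m by (intro measure_UNION_le) auto
      also have "\<dots> \<le> (\<Sum>i<N. e / 2 * (1/2)^Suc i)" by (intro sum_mono less_imp_le small)
      also have "\<dots> = e / 2 * (1 - (1/2)^N)"
        by (simp add: sum_distrib_left[symmetric] sum_gp_strict sum_divide_distrib[symmetric])
      also have "\<dots> \<le> e / 2" using \<open>0 < e\<close> by (simp add: field_simps)
      finally show ?thesis using small(1) by simp
    qed
    \<comment> \<open>For \<open>N = 0\<close> the maximum is taken over the empty set, which is
      harmless because the union is then empty.\<close>
    have "cylinder (Max (k ` {..<N})) ?B"
      by (intro cylinder_UN cylinder_mono[OF B(1)]) auto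
    moreover have "?B \<in> sets P" using B(2) by auto
    ultimately show ?case
      using fin[OF \<open>finite_measure P\<close> refl N1 B(3)] fin[OF \<open>finite_measure Q\<close> PQ[symmetric] N2 B(4)]
      by (intro exI conjI) (auto simp: N_def)
  qed
qed

section \<open>Gaussian shifts\<close>

text \<open>The common interface of the real and the complex case: \<open>shift\<close> gives the
  density of a translated coordinate, \<open>char\<close> its characteristic function. The inner
  product is the real one, so a complex coordinate counts as a standard Gaussian vector in the
  plane.\<close>

locale gaussian_noise = prob_space G
  for G :: "'a::{real_normed_field, euclidean_space} measure" +
  assumes sets_G [measurable_cong, simp]: "sets G = sets borel"
    and shift: "\<And>f s. f \<in> borel_measurable borel \<Longrightarrow>
      (\<integral>\<^sup>+y. f (s + y) \<partial>G) = (\<integral>\<^sup>+y. f y * ennreal (exp (inner y s - (norm s)\<^sup>2 / 2)) \<partial>G)"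
    and char: "\<And>u. (CLINT y|G. iexp (inner y u)) = complex_of_real (exp (- (norm u)\<^sup>2 / 2))"
begin

lemma space_G [simp]: "space G = UNIV"
  using sets_eq_imp_space_eq[OF sets_G] by simp

section \<open>Likelihood ratios of shifted noise; obstructions to detection and recovery\<close>

abbreviation N :: "(nat \<Rightarrow> 'a) measure" where "N \<equiv> PiM UNIV (\<lambda>_. G)"

sublocale N: prob_space N by (intro prob_space_PiM prob_space_axioms)

lemma space_N [simp]: "space N = UNIV" by (simp add: space_PiM)

lemma emeasure_UNIV [simp]: "emeasure G UNIV = 1" "emeasure N UNIV = 1"
  using emeasure_space_1 N.emeasure_space_1 by simp_all

lemma sets_N: "sets N = sets borel" using sets_noise[OF sets_G] by (simp add: noise_def)

text \<open>Take the constant function 1 in \<open>shift\<close>: the density of the translated law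
  has total mass 1. Multiplying by the inverse exponential then isolates the integral without
  dividing in \<open>ennreal\<close>.\<close>

lemma mgf: "(\<integral>\<^sup>+y. ennreal (exp (inner y s)) \<partial>G) = ennreal (exp ((norm s)\<^sup>2 / 2))"
proof -
  have "1 = (\<integral>\<^sup>+y. ennreal (exp (inner y s - (norm s)\<^sup>2 / 2)) \<partial>G)"
    using shift[of "\<lambda>_. 1" s] by simp
  also have "\<dots> = (\<integral>\<^sup>+y. ennreal (exp (- (norm s)\<^sup>2 / 2)) * ennreal (exp (inner y s)) \<partial>G)"
    by (simp add: ennreal_mult[symmetric] exp_add[symmetric] field_simps)
  also have "\<dots> = ennreal (exp (- (norm s)\<^sup>2 / 2)) * (\<integral>\<^sup>+y. ennreal (exp (inner y s)) \<partial>G)"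
    by (subst nn_integral_cmult) auto
  finally have eq: "ennreal (exp (- (norm s)\<^sup>2 / 2)) * (\<integral>\<^sup>+y. ennreal (exp (inner y s)) \<partial>G) = 1"
    by simp
  have "(\<integral>\<^sup>+y. ennreal (exp (inner y s)) \<partial>G)
      = ennreal (exp ((norm s)\<^sup>2 / 2)) * (ennreal (exp (- (norm s)\<^sup>2 / 2)) * (\<integral>\<^sup>+y. ennreal (exp (inner y s)) \<partial>G))"
    by (simp add: mult.assoc[symmetric] ennreal_mult[symmetric] exp_add[symmetric])
  then show ?thesis unfolding eq by simp
qed

text \<open>The density, with respect to \<open>G\<close>, of the law of \<open>s + y\<close> when
  \<open>y\<close> has law \<open>G\<close>.\<close>

definition lik :: "'a \<Rightarrow> 'a \<Rightarrow> real" where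
  "lik s y = exp (inner y s - (norm s)\<^sup>2 / 2)"

lemma lik_pos: "0 < lik s y" by (simp add: lik_def)

lemma measurable_lik [measurable (raw)]:
  assumes [measurable]: "f \<in> borel_measurable M" "g \<in> borel_measurable M"
  shows "(\<lambda>p. lik (f p) (g p)) \<in> borel_measurable M"
  unfolding lik_def by measurable

text \<open>The product is a constant times \<open>exp (inner y (s + t))\<close>, and
  \<open>mgf\<close> at \<open>s + t\<close> leaves only the cross term of the squared norm. This is
  where the overlap of two signals enters.\<close>

lemma lik_mult: "(\<integral>\<^sup>+y. ennreal (lik s y) * ennreal (lik t y) \<partial>G) = ennreal (exp (inner s t))"
proof -
  have "lik s y * lik t y = exp (- ((norm s)\<^sup>2 + (norm t)\<^sup>2) / 2) * exp (inner y (s + t))" for y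
    by (simp add: lik_def exp_add[symmetric] inner_add_right field_simps)
  then have "(\<integral>\<^sup>+y. ennreal (lik s y) * ennreal (lik t y) \<partial>G)
      = (\<integral>\<^sup>+y. ennreal (exp (- ((norm s)\<^sup>2 + (norm t)\<^sup>2) / 2)) * ennreal (exp (inner y (s + t))) \<partial>G)"
    by (simp add: ennreal_mult[symmetric] lik_pos less_imp_le)
  also have "\<dots> = ennreal (exp (- ((norm s)\<^sup>2 + (norm t)\<^sup>2) / 2)) * ennreal (exp ((norm (s + t))\<^sup>2 / 2))"
    by (subst nn_integral_cmult) (auto simp: mgf)
  also have "\<dots> = ennreal (exp (inner s t))"
    by (simp add: ennreal_mult[symmetric] exp_add[symmetric] power2_norm_eq_inner inner_add
        inner_commute field_simps)
  finally show ?thesis .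
qed

lemma nn_integral_shift_coord:
  assumes [measurable]: "f \<in> borel_measurable N"
  shows "(\<integral>\<^sup>+w. f (w(m := s + w m)) \<partial>N) = (\<integral>\<^sup>+w. f w * ennreal (lik s (w m)) \<partial>N)"
proof -
  have [measurable]: "(\<lambda>y. f (w(m := y))) \<in> borel_measurable borel" for w
  proof -
    have "(\<lambda>y. w(m := y)) \<in> borel \<rightarrow>\<^sub>M N"
      by (rule measurable_PiM_single') (auto simp: space_PiM PiE_iff)
    then show ?thesis by measurable
  qed
  have "(\<lambda>w. w(m := s + w m)) \<in> N \<rightarrow>\<^sub>M N"
    by (rule measurable_PiM_single') (auto simp: space_PiM PiE_iff)
  then have "(\<integral>\<^sup>+w. f (w(m := s + w m)) \<partial>N) = (\<integral>\<^sup>+w. \<integral>\<^sup>+y. f (w(m := s + y)) \<partial>G \<partial>N)"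
    by (subst nn_integral_PiM_update[OF prob_space_axioms, where m = m]) auto
  also have "\<dots> = (\<integral>\<^sup>+w. \<integral>\<^sup>+y. f (w(m := y)) * ennreal (lik s y) \<partial>G \<partial>N)"
    unfolding lik_def by (subst shift[symmetric]) auto
  also have "\<dots> = (\<integral>\<^sup>+w. f w * ennreal (lik s (w m)) \<partial>N)"
    by (subst (2) nn_integral_PiM_update[OF prob_space_axioms, where m = m]) auto
  finally show ?thesis .
qed

text \<open>Only finitely many coordinates are shifted, so a density exists for every
  \<open>x\<close>; the full shift may be singular. In the induction the new likelihood factor is
  absorbed into \<open>f\<close>, which is why \<open>f\<close> is generalized.\<close>

lemma cameron_martin:
  assumes "f \<in> borel_measurable N"
  shows "(\<integral>\<^sup>+w. f (\<lambda>n. if n < k then x n + w n else w n) \<partial>N)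
    = (\<integral>\<^sup>+w. f w * (\<Prod>n<k. ennreal (lik (x n) (w n))) \<partial>N)"
  using assms
proof (induction k arbitrary: f)
  case (Suc k)
  note [measurable] = Suc.prems
  let ?s = "\<lambda>k w n. if n < k then x n + w n else w n"
  have [measurable]: "?s k \<in> N \<rightarrow>\<^sub>M N" for k
    by (rule measurable_PiM_single') (auto simp: space_PiM PiE_iff)
  have "?s (Suc k) w = ?s k (w(k := x k + w k))" for w
    by (auto simp: fun_eq_iff less_Suc_eq)
  then have "(\<integral>\<^sup>+w. f (?s (Suc k) w) \<partial>N) = (\<integral>\<^sup>+w. f (?s k (w(k := x k + w k))) \<partial>N)" by metis
  also have "\<dots> = (\<integral>\<^sup>+w. f (?s k w) * ennreal (lik (x k) (w k)) \<partial>N)"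
    by (rule nn_integral_shift_coord[where f = "\<lambda>w. f (?s k w)"]) measurable
  also have "\<dots> = (\<integral>\<^sup>+w. (\<lambda>v. f v * ennreal (lik (x k) (v k))) (?s k w) \<partial>N)" by simp
  also have "\<dots> = (\<integral>\<^sup>+w. f w * ennreal (lik (x k) (w k)) * (\<Prod>n<k. ennreal (lik (x n) (w n))) \<partial>N)"
    by (rule Suc.IH) measurable
  finally show ?case by (simp add: mult_ac)
qed simp

text \<open>A detector yields an event \<open>A\<close> that is null under the noise and has mass 1
  under the mixture \<open>Q\<close> of the shifted laws. Replace it by a nearby cylinder
  \<open>B\<close>: there \<open>Q\<close> is given by a density with second moment at most
  \<open>C\<close>, so small noise mass forces small mass under \<open>Q\<close>. Arbitrarily large
  good \<open>k\<close> suffice, because a cylinder stays one when \<open>k\<close> grows.\<close>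

lemma no_detection:
  fixes E :: "'e measure" and x :: "'e \<Rightarrow> nat \<Rightarrow> 'a"
  assumes "prob_space E" and x [measurable]: "\<And>n. (\<lambda>e. x e n) \<in> borel_measurable E"
    and X: "\<And>e. e \<in> space E \<Longrightarrow> x e \<in> X" and C: "0 < (C::real)"
    and bound: "\<And>K. \<exists>k\<ge>K. \<forall>e\<in>space E.
      (\<integral>\<^sup>+e'. ennreal (exp (\<Sum>n<k. inner (x e n) (x e' n))) \<partial>E) \<le> ennreal C"
  shows "\<not> admits_detection G X"
proof
  interpret E: prob_space E by fact
  interpret NE: pair_sigma_finite E N ..
  interpret EN: pair_sigma_finite N E ..
  assume "admits_detection G X"
  then obtain T :: "(nat \<Rightarrow> 'a) \<Rightarrow> nat" where T: "T \<in> borel \<rightarrow>\<^sub>M count_space {0, 1}"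
    and T0: "AE w in N. T w = 0"
    and T1: "\<And>x. x \<in> X \<Longrightarrow> AE w in N. T (\<lambda>n. x n + w n) = 1"
    unfolding admits_detection_def noise_def by blast
  define A where "A = {w. T w = 1}"
  have A [measurable]: "A \<in> sets N"
    using measurable_sets[OF T, of "{1}"] by (simp add: A_def sets_N vimage_def)
  have plus [measurable]: "(\<lambda>p n. x (fst p) n + snd p n) \<in> E \<Otimes>\<^sub>M N \<rightarrow>\<^sub>M N"
    by (rule measurable_PiM_single') (auto simp: space_PiM)
  define Q where "Q = distr (E \<Otimes>\<^sub>M N) N (\<lambda>p n. x (fst p) n + snd p n)"
  interpret ENp: prob_space "E \<Otimes>\<^sub>M N"
    using E.prob_space_axioms N.prob_space_axioms by (rule prob_space_pair)
  interpret Q: prob_space Q unfolding Q_def by (rule ENp.prob_space_distr) measurable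
  have plus1 [measurable]: "(\<lambda>w n. x e n + w n) \<in> N \<rightarrow>\<^sub>M N" for e
    by (rule measurable_PiM_single') (auto simp: space_PiM)
  have emQ: "emeasure Q B = (\<integral>\<^sup>+e. \<integral>\<^sup>+w. indicator B (\<lambda>n. x e n + w n) \<partial>N \<partial>E)"
    if [measurable]: "B \<in> sets N" for B
  proof -
    have "emeasure Q B = (\<integral>\<^sup>+w. indicator B w \<partial>Q)"
      using that by (simp add: Q_def)
    also have "\<dots> = (\<integral>\<^sup>+p. indicator B (\<lambda>n. x (fst p) n + snd p n) \<partial>(E \<Otimes>\<^sub>M N))"
      unfolding Q_def by (rule nn_integral_distr) measurable
    also have "\<dots> = (\<integral>\<^sup>+e. \<integral>\<^sup>+w. indicator B (\<lambda>n. x e n + w n) \<partial>N \<partial>E)"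
      by (subst N.nn_integral_fst[symmetric]) auto
    finally show ?thesis .
  qed
  have QA1: "(\<integral>\<^sup>+w. indicator A (\<lambda>n. x e n + w n) \<partial>N) = 1" if "e \<in> space E" for e
  proof -
    have "(\<integral>\<^sup>+w. indicator A (\<lambda>n. x e n + w n) \<partial>N) = (\<integral>\<^sup>+w. 1 \<partial>N)"
      using T1[OF X[OF that]] by (intro nn_integral_cong_AE) (auto simp: A_def elim!: eventually_mono)
    then show ?thesis by simp
  qed
  have "emeasure Q A = (\<integral>\<^sup>+e. 1 \<partial>E)"
    unfolding emQ[OF A] by (rule nn_integral_cong) (rule QA1)
  then have QA: "measure Q A = 1" by (simp add: E.emeasure_space_1 measure_def)
  have NA: "measure N A = 0"
    using T0 A by (subst N.prob_eq_0) (auto simp: A_def elim!: eventually_mono)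
  \<comment> \<open>The first bound makes the mass of \<open>B\<close> under \<open>Q\<close> at
    least 3/4. The second makes it at most 1/2: the weight \<open>4 * C\<close> used below bounds it
    by \<open>4 * C * measure N B + 1/4\<close>.\<close>
  define e where "e = min (1/4) (1 / (16 * C))"
  have e: "0 < e" "e \<le> 1/4" "4 * C * e \<le> 1/4" using C by (auto simp: e_def field_simps min_def)
  obtain k0 B where B: "cylinder k0 B" and [measurable]: "B \<in> sets N" and
    small: "measure N (sym_diff A B) < e" "measure Q (sym_diff A B) < e"
    using cylinder_approx[of N Q G A e] e(1) A N.finite_measure_axioms Q.finite_measure_axioms
    by (auto simp: Q_def)
  obtain k where k: "k \<ge> k0" and bd: "\<And>e. e \<in> space E \<Longrightarrow>
      (\<integral>\<^sup>+e'. ennreal (exp (\<Sum>n<k. inner (x e n) (x e' n))) \<partial>E) \<le> ennreal C"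
    using bound by blast
  have Bk: "cylinder k B" using B k by (rule cylinder_mono)
  have [measurable]: "B \<in> sets Q" "A \<in> sets Q" by (simp_all add: Q_def A)
  have "measure N B \<le> measure N (A \<union> sym_diff A B)" by (intro N.finite_measure_mono) auto
  also have "\<dots> \<le> measure N A + measure N (sym_diff A B)" by (intro measure_Un_le) auto
  finally have NB: "measure N B \<le> e" using NA small by simp
  have "measure Q A \<le> measure Q (B \<union> sym_diff A B)" by (intro Q.finite_measure_mono) auto
  also have "\<dots> \<le> measure Q B + measure Q (sym_diff A B)" by (intro measure_Un_le) auto
  finally have QB: "3/4 \<le> measure Q B" using QA small e by simp
  define L where "L = (\<lambda>e w. \<Prod>n<k. ennreal (lik (x e n) (w n)))"
  have L1 [measurable]: "(\<lambda>p. L (fst p) (snd p)) \<in> borel_measurable (E \<Otimes>\<^sub>M N)"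
    unfolding L_def by measurable
  have L1' [measurable]: "(\<lambda>p. L (snd p) (fst p)) \<in> borel_measurable (N \<Otimes>\<^sub>M E)"
    unfolding L_def by measurable
  have L2 [measurable]: "L e \<in> borel_measurable N" for e
    unfolding L_def by measurable
  have L3 [measurable]: "(\<lambda>e. L e w) \<in> borel_measurable E" for w
    unfolding L_def by measurable
  have inner: "(\<integral>\<^sup>+w. indicator B (\<lambda>n. x e n + w n) \<partial>N) = (\<integral>\<^sup>+w. indicator B w * L e w \<partial>N)" for e
  proof -
    \<comment> \<open>Membership in \<open>B\<close> depends only on coordinates below
      \<open>k\<close>, so the shift beyond them may be dropped and \<open>cameron_martin\<close>
      applies.\<close>
    have "indicator B (\<lambda>n. x e n + w n) = (indicator B (\<lambda>n. if n < k then x e n + w n else w n) :: ennreal)" for w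
    proof -
      have "(\<lambda>n. x e n + w n) \<in> B \<longleftrightarrow> (\<lambda>n. if n < k then x e n + w n else w n) \<in> B"
        by (rule Bk[unfolded cylinder_def, rule_format]) simp
      then show ?thesis by (simp add: indicator_def)
    qed
    then show ?thesis unfolding L_def using cameron_martin[of "indicator B" k "x e"] by simp
  qed
  define Lm where "Lm = (\<lambda>w. \<integral>\<^sup>+e. L e w \<partial>E)"
  have [measurable]: "Lm \<in> borel_measurable N"
    unfolding Lm_def using L1' by (intro E.borel_measurable_nn_integral) (simp add: case_prod_beta')
  have "emeasure Q B = (\<integral>\<^sup>+e. \<integral>\<^sup>+w. indicator B w * L e w \<partial>N \<partial>E)"
    by (simp add: emQ inner)
  also have "\<dots> = (\<integral>\<^sup>+w. \<integral>\<^sup>+e. indicator B w * L e w \<partial>E \<partial>N)"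
    by (rule EN.Fubini') (simp add: case_prod_beta')
  also have "\<dots> = (\<integral>\<^sup>+w. indicator B w * Lm w \<partial>N)" unfolding Lm_def
    by (intro nn_integral_cong nn_integral_cmult) simp
  also have "\<dots> \<le> (\<integral>\<^sup>+w. ennreal (4 * C) * indicator B w + ennreal (1 / (4 * C)) * (Lm w * Lm w) \<partial>N)"
  proof (intro nn_integral_mono)
    fix w
    \<comment> \<open>A weighted AM-GM bound takes the place of the Cauchy-Schwarz inequality.\<close>
    have am: "l \<le> ennreal (4 * C) + ennreal (1 / (4 * C)) * (l * l)" for l :: ennreal
    proof (cases "l \<le> ennreal (4 * C)")
      case True
      then show ?thesis by (rule order_trans) simp
    next
      case False
      have "l = ennreal (1 / (4 * C)) * ennreal (4 * C) * l"
        using C by (subst ennreal_mult[symmetric]) auto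
      also have "\<dots> \<le> ennreal (1 / (4 * C)) * l * l"
        using False by (intro mult_right_mono mult_left_mono) auto
      also have "\<dots> \<le> ennreal (4 * C) + ennreal (1 / (4 * C)) * (l * l)"
        by (simp add: mult.assoc)
      finally show ?thesis .
    qed
    show "indicator B w * Lm w \<le> ennreal (4 * C) * indicator B w + ennreal (1 / (4 * C)) * (Lm w * Lm w)"
      using am[of "Lm w"] by (auto simp: indicator_def)
  qed
  also have "\<dots> = ennreal (4 * C) * emeasure N B + ennreal (1 / (4 * C)) * (\<integral>\<^sup>+w. Lm w * Lm w \<partial>N)"
    by (subst nn_integral_add) (auto simp: nn_integral_cmult)
  also have "(\<integral>\<^sup>+w. Lm w * Lm w \<partial>N) \<le> ennreal C"
  proof -
    have [measurable]: "(\<lambda>p. L (snd p) (fst p) * Lm (fst p)) \<in> borel_measurable (N \<Otimes>\<^sub>M E)"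
      by measurable
    \<comment> \<open>The square of the mixture density is unfolded into two independent draws
      \<open>e\<close> and \<open>e'\<close> from the prior; integrating over the noise first leaves
      the overlap in \<open>bound\<close>.\<close>
    have "(\<integral>\<^sup>+w. Lm w * Lm w \<partial>N) = (\<integral>\<^sup>+w. \<integral>\<^sup>+e. L e w * Lm w \<partial>E \<partial>N)"
      by (intro nn_integral_cong) (subst (1) Lm_def, subst nn_integral_multc, auto)
    also have "\<dots> = (\<integral>\<^sup>+e. \<integral>\<^sup>+w. L e w * Lm w \<partial>N \<partial>E)"
      by (rule NE.Fubini') (simp add: case_prod_beta')
    also have "\<dots> \<le> (\<integral>\<^sup>+e. ennreal C \<partial>E)"
    proof (intro nn_integral_mono)
      fix e assume e: "e \<in> space E"
      have "(\<integral>\<^sup>+w. L e w * Lm w \<partial>N) = (\<integral>\<^sup>+w. \<integral>\<^sup>+e'. L e w * L e' w \<partial>E \<partial>N)"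
        unfolding Lm_def by (intro nn_integral_cong nn_integral_cmult[symmetric]) auto
      also have "\<dots> = (\<integral>\<^sup>+e'. \<integral>\<^sup>+w. L e w * L e' w \<partial>N \<partial>E)"
        by (rule NE.Fubini') (simp add: case_prod_beta')
      also have "\<dots> = (\<integral>\<^sup>+e'. ennreal (exp (\<Sum>n<k. inner (x e n) (x e' n))) \<partial>E)"
      proof (intro nn_integral_cong)
        fix e'
        have "(\<integral>\<^sup>+w. L e w * L e' w \<partial>N)
            = (\<integral>\<^sup>+w. (\<Prod>n<k. ennreal (lik (x e n) (w n)) * ennreal (lik (x e' n) (w n))) \<partial>N)"
          by (simp add: L_def prod.distrib)
        also have "\<dots> = (\<Prod>n<k. ennreal (exp (inner (x e n) (x e' n))))"
          by (subst nn_integral_PiM_prod[OF prob_space_axioms,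
                where f = "\<lambda>n y. ennreal (lik (x e n) y) * ennreal (lik (x e' n) y)"])
             (auto simp: lik_mult)
        finally show "(\<integral>\<^sup>+w. L e w * L e' w \<partial>N) = ennreal (exp (\<Sum>n<k. inner (x e n) (x e' n)))"
          by (simp add: prod_ennreal exp_sum)
      qed
      finally show "(\<integral>\<^sup>+w. L e w * Lm w \<partial>N) \<le> ennreal C" using bd[OF e] by simp
    qed
    finally show ?thesis by (simp add: E.emeasure_space_1)
  qed
  finally have "ennreal (measure Q B) \<le> ennreal (4 * C) * ennreal (measure N B) + ennreal (1 / (4 * C)) * ennreal C"
    by (simp add: Q.emeasure_eq_measure N.emeasure_eq_measure add_left_mono mult_left_mono)
  also have "\<dots> = ennreal (4 * C * measure N B + 1 / 4)"
    using C by (simp add: ennreal_mult[symmetric] ennreal_plus[symmetric] del: ennreal_plus)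
  finally have "measure Q B \<le> 4 * C * measure N B + 1/4"
    using C by (subst (asm) ennreal_le_iff) auto
  moreover have "4 * C * measure N B \<le> 4 * C * e" using NB C by (intro mult_left_mono) auto
  ultimately show False using QB e by linarith
qed

text \<open>The noise with one coordinate translated has a density with respect to the noise, so it
  does not charge the exceptional null set.\<close>

lemma AE_shift_coord:
  assumes "AE w in N. P w" and [measurable]: "{w. P w} \<in> sets N"
  shows "AE w in N. P (w(m := s + w m))"
proof -
  have [measurable]: "(\<lambda>w. w(m := s + w m)) \<in> N \<rightarrow>\<^sub>M N"
    by (rule measurable_PiM_single') (auto simp: space_PiM PiE_iff)
  have [measurable]: "- {w. P w} \<in> sets N"
    using sets.compl_sets[OF assms(2)] by (simp add: Compl_eq_Diff_UNIV)
  have "(\<integral>\<^sup>+w. indicator (- {w. P w}) (w(m := s + w m)) \<partial>N)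
      = (\<integral>\<^sup>+w. indicator (- {w. P w}) w * ennreal (lik s (w m)) \<partial>N)"
    by (rule nn_integral_shift_coord) measurable
  also have "\<dots> = (\<integral>\<^sup>+w. 0 \<partial>N)"
    using assms(1) by (intro nn_integral_cong_AE) (auto elim!: eventually_mono)
  finally have "(\<integral>\<^sup>+w. indicator (- {w. P w}) (w(m := s + w m)) \<partial>N) = 0" by simp
  then have "AE w in N. indicator (- {w. P w}) (w(m := s + w m)) = (0::ennreal)"
    by (subst (asm) nn_integral_0_iff_AE) auto
  then show ?thesis by eventually_elim (auto simp: indicator_def split: if_splits)
qed

text \<open>The two observations differ by a translation of one coordinate. The almost sure event
  for \<open>x\<close> therefore transfers to observations of \<open>x'\<close>, and
  \<open>T\<close> would have to return both signals at once.\<close>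

lemma no_recovery:
  assumes x: "x \<in> X" "x' \<in> X" and "x m \<noteq> x' m" and eq: "\<And>n. n \<noteq> m \<Longrightarrow> x n = x' n"
  shows "\<not> admits_recovery G X"
proof
  assume "admits_recovery G X"
  then obtain T :: "(nat \<Rightarrow> 'a) \<Rightarrow> (nat \<Rightarrow> 'a)" where T: "T \<in> borel \<rightarrow>\<^sub>M borel"
    and Tx: "\<And>x. x \<in> X \<Longrightarrow> AE w in N. T (\<lambda>n. x n + w n) = x"
    unfolding admits_recovery_def noise_def by blast
  have T' [measurable]: "T \<in> N \<rightarrow>\<^sub>M borel" using T by (simp add: measurable_cong_sets[OF sets_N refl])
  have [measurable]: "(\<lambda>w n. x n + w n) \<in> N \<rightarrow>\<^sub>M N"
    by (rule measurable_PiM_single') (auto simp: space_PiM)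
  have "{w. T (\<lambda>n. x n + w n) = x} \<in> sets N"
    using measurable_sets[of "\<lambda>w. T (\<lambda>n. x n + w n)" N borel "{x}"] by (simp add: vimage_def)
  from AE_shift_coord[OF Tx[OF x(1)] this, of m "x' m - x m"]
  have "AE w in N. T (\<lambda>n. x n + (w(m := x' m - x m + w m)) n) = x" .
  moreover have "(\<lambda>n. x n + (w(m := x' m - x m + w m)) n) = (\<lambda>n. x' n + w n)" for w
    using eq by (auto simp: fun_eq_iff)
  ultimately have "AE w in N. T (\<lambda>n. x' n + w n) = x" by simp
  with Tx[OF x(2)] have "AE w in N. x = x'" by eventually_elim simp
  then show False using \<open>x m \<noteq> x' m\<close> by simp
qed

end

section \<open>Real and complex Gaussians\<close>

lemma gaussian_noise_real: "gaussian_noise std_gaussian_real"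
proof -
  interpret prob_space std_gaussian_real
    unfolding std_gaussian_real_def by (rule prob_space_normal_density) simp
  show ?thesis
  proof unfold_locales
    fix f :: "real \<Rightarrow> ennreal" and s :: real
    assume [measurable]: "f \<in> borel_measurable borel"
    have dens: "std_normal_density (y - s) = std_normal_density y * exp (y * s - s\<^sup>2 / 2)" for y
      by (simp add: std_normal_density_def exp_add[symmetric] power2_diff field_simps)
    have "(\<integral>\<^sup>+y. f (s + y) \<partial>std_gaussian_real)
        = (\<integral>\<^sup>+y. ennreal (std_normal_density y) * f (s + y) \<partial>lborel)"
      unfolding std_gaussian_real_def by (subst nn_integral_density) auto
    also have "\<dots> = (\<integral>\<^sup>+y. ennreal (std_normal_density (y - s)) * f y \<partial>lborel)"
      by (subst (2) nn_integral_real_affine[where c = 1 and t = s]) auto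
    also have "\<dots> = (\<integral>\<^sup>+y. f y * ennreal (exp (inner y s - (norm s)\<^sup>2 / 2)) \<partial>std_gaussian_real)"
      unfolding std_gaussian_real_def dens
      by (subst nn_integral_density) (auto simp: ennreal_mult mult_ac)
    finally show "(\<integral>\<^sup>+y. f (s + y) \<partial>std_gaussian_real)
        = (\<integral>\<^sup>+y. f y * ennreal (exp (inner y s - (norm s)\<^sup>2 / 2)) \<partial>std_gaussian_real)" .
  next
    fix u :: real
    show "(CLINT y|std_gaussian_real. iexp (inner y u)) = complex_of_real (exp (- (norm u)\<^sup>2 / 2))"
      using fun_cong[OF char_std_normal_distribution, of u]
      by (simp add: char_def std_gaussian_real_def mult.commute)
  qed simp
qed

lemma measurable_Complex [measurable (raw)]:
  assumes [measurable]: "f \<in> borel_measurable M" "g \<in> borel_measurable M"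
  shows "(\<lambda>p. Complex (f p) (g p)) \<in> borel_measurable M"
  unfolding Complex_eq by measurable

text \<open>The real inner product splits into real and imaginary parts, so the likelihood factor is
  a product and the two components are shifted one after the other. The characteristic function
  factors in the same way.\<close>

lemma gaussian_noise_complex: "gaussian_noise std_gaussian_complex"
proof -
  let ?G = std_gaussian_real
  interpret R: gaussian_noise ?G by (rule gaussian_noise_real)
  interpret RR: pair_prob_space ?G ?G ..
  have m [measurable]: "(\<lambda>(u, v). Complex u v) \<in> borel_measurable (?G \<Otimes>\<^sub>M ?G)"
    by (simp add: case_prod_beta')
  interpret prob_space std_gaussian_complex
    unfolding std_gaussian_complex_def by (rule RR.prob_space_distr) (rule m)
  show ?thesis
  proof unfold_locales
    fix f :: "complex \<Rightarrow> ennreal" and s :: complex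
    assume [measurable]: "f \<in> borel_measurable borel"
    have nn: "(\<integral>\<^sup>+y. h y \<partial>std_gaussian_complex) = (\<integral>\<^sup>+u. \<integral>\<^sup>+v. h (Complex u v) \<partial>?G \<partial>?G)"
      if [measurable]: "h \<in> borel_measurable borel" for h
      unfolding std_gaussian_complex_def
      by (subst nn_integral_distr[OF m])
         (simp_all add: case_prod_beta' R.nn_integral_fst[symmetric])
    define h where "h = (\<lambda>y. f y * ennreal (exp (inner y s - (norm s)\<^sup>2 / 2)))"
    have [measurable]: "h \<in> borel_measurable borel" unfolding h_def by measurable
    have h: "h (Complex u v) = f (Complex u v) * ennreal (exp (inner v (Im s) - (norm (Im s))\<^sup>2 / 2))
        * ennreal (exp (inner u (Re s) - (norm (Re s))\<^sup>2 / 2))" for u v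
      by (simp add: h_def mult.assoc ennreal_mult[symmetric] exp_add[symmetric] inner_complex_def
          cmod_power2 algebra_simps add_divide_distrib diff_divide_distrib)
    have "(\<integral>\<^sup>+y. f (s + y) \<partial>std_gaussian_complex)
        = (\<integral>\<^sup>+u. \<integral>\<^sup>+v. f (Complex (Re s + u) (Im s + v)) \<partial>?G \<partial>?G)"
      by (subst nn) (simp_all add: complex_eq_iff plus_complex.code)
    also have "\<dots> = (\<integral>\<^sup>+u. \<integral>\<^sup>+v. f (Complex (Re s + u) v)
        * ennreal (exp (inner v (Im s) - (norm (Im s))\<^sup>2 / 2)) \<partial>?G \<partial>?G)"
      by (subst R.shift[symmetric]) simp_all
    also have "\<dots> = (\<integral>\<^sup>+u. (\<integral>\<^sup>+v. f (Complex u v)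
        * ennreal (exp (inner v (Im s) - (norm (Im s))\<^sup>2 / 2)) \<partial>?G)
        * ennreal (exp (inner u (Re s) - (norm (Re s))\<^sup>2 / 2)) \<partial>?G)"
      by (subst R.shift[symmetric]) (simp_all add: R.borel_measurable_nn_integral)
    also have "\<dots> = (\<integral>\<^sup>+u. \<integral>\<^sup>+v. h (Complex u v) \<partial>?G \<partial>?G)"
      unfolding h by (subst nn_integral_multc) simp_all
    also have "\<dots> = (\<integral>\<^sup>+y. h y \<partial>std_gaussian_complex)" by (subst nn) simp_all
    finally show "(\<integral>\<^sup>+y. f (s + y) \<partial>std_gaussian_complex)
        = (\<integral>\<^sup>+y. f y * ennreal (exp (inner y s - (norm s)\<^sup>2 / 2)) \<partial>std_gaussian_complex)"
      by (simp add: h_def)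
  next
    fix w :: complex
    have int: "integrable (?G \<Otimes>\<^sub>M ?G) (\<lambda>p. iexp (fst p * Re w) * iexp (snd p * Im w))"
      by (intro RR.integrable_const_bound[where B = 1]) (auto simp: norm_mult)
    have "(CLINT y|std_gaussian_complex. iexp (inner y w))
        = (CLINT p|?G \<Otimes>\<^sub>M ?G. iexp (fst p * Re w) * iexp (snd p * Im w))"
      unfolding std_gaussian_complex_def
      by (subst integral_distr[OF m])
         (simp_all add: case_prod_beta' inner_complex_def exp_add[symmetric] algebra_simps)
    also have "\<dots> = (CLINT u|?G. CLINT v|?G. iexp (u * Re w) * iexp (v * Im w))"
      by (subst RR.integral_fst'[OF int, symmetric]) simp
    also have "\<dots> = (CLINT u|?G. iexp (inner u (Re w))) * (CLINT v|?G. iexp (inner v (Im w)))"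
      by simp
    also have "\<dots> = complex_of_real (exp (- (norm w)\<^sup>2 / 2))"
      unfolding R.char
      by (simp add: of_real_mult[symmetric] exp_add[symmetric] cmod_power2 field_simps del: of_real_mult)
    finally show "(CLINT y|std_gaussian_complex. iexp (inner y w))
        = complex_of_real (exp (- (norm w)\<^sup>2 / 2))" .
  qed simp
qed

section \<open>The Rademacher space\<close>

text \<open>The coins stay Boolean and \<open>pm\<close> turns them into real signs, so that one
  prior serves both fields.\<close>

definition coins :: "(nat \<Rightarrow> bool) measure" where
  "coins = PiM UNIV (\<lambda>_. measure_pmf (bernoulli_pmf (1/2)))"

definition pm :: "bool \<Rightarrow> real" where "pm b = (if b then 1 else - 1)"

lemma prob_space_coins: "prob_space coins"
  unfolding coins_def by (intro prob_space_PiM prob_space_measure_pmf)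

lemma space_coins [simp]: "space coins = UNIV" by (simp add: coins_def space_PiM)

lemma measurable_coins_component [measurable]: "(\<lambda>e. f (e n)) \<in> coins \<rightarrow>\<^sub>M borel"
  unfolding coins_def by (rule measurable_compose[OF measurable_component_singleton]) auto

lemma nn_integral_coins_prod:
  assumes "finite J"
  shows "(\<integral>\<^sup>+e. (\<Prod>j\<in>J. ennreal (f j (e j))) \<partial>coins)
    = (\<Prod>j\<in>J. ennreal (f j True) / 2 + ennreal (f j False) / 2)"
  unfolding coins_def
  by (subst nn_integral_PiM_prod[OF prob_space_measure_pmf assms])
     (auto simp: ennreal_divide_numeral[symmetric] divide_ennreal_def)

lemma ennreal_add_halves:
  assumes "0 \<le> a" "0 \<le> b"
  shows "ennreal a / 2 + ennreal b / 2 = ennreal ((a + b) / 2)"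
proof -
  have "ennreal a / 2 + ennreal b / 2 = ennreal (a / 2) + ennreal (b / 2)"
    using divide_ennreal[of a 2] divide_ennreal[of b 2] assms by simp
  then show ?thesis using assms by (simp add: add_divide_distrib flip: ennreal_plus)
qed

text \<open>Hoeffding's estimate for a fair two-point variable, with \<open>h = 2 * x\<close> and
  \<open>p = 1/2\<close>; negative \<open>x\<close> follows by evenness.\<close>

lemma cosh_le_exp_power2: "cosh x \<le> exp (x\<^sup>2 / 2)" for x :: real
proof -
  have *: "cosh x \<le> exp (x\<^sup>2 / 2)" if "0 \<le> x" for x :: real
  proof -
    have "1 + 1/2 * (exp (2 * x) - 1) = exp x * cosh x"
      by (simp add: cosh_def algebra_simps exp_add[symmetric])
    then have "ln (cosh x) \<le> x\<^sup>2 / 2"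
      using Hoeffdings_lemma_aux[of "2 * x" "1/2"] that
      by (simp add: ln_mult cosh_real_pos power_mult_distrib)
    then show ?thesis by (metis cosh_real_pos exp_le_cancel_iff exp_ln)
  qed
  show ?thesis using *[of x] *[of "- x"] by (cases "0 \<le> x") auto
qed

text \<open>Taylor expansion to fourth order: the remainder is at most c^4/24, hence at most c^2/24
  on the unit interval, which leaves more than the claimed half of c^2/2.\<close>

lemma one_minus_cos_ge: "1 - cos c \<ge> c\<^sup>2 / 4" if "0 \<le> c" "c \<le> 1" for c :: real
proof -
  have "{..<4} = {0, 1, 2, 3::nat}" by auto
  then have sum4: "(\<Sum>m<4. cos_coeff m * c ^ m) = 1 - c\<^sup>2 / 2"
    by (simp add: cos_coeff_def)
  obtain t where "cos c = (\<Sum>m<4. cos_coeff m * c ^ m) + cos (t + 1/2 * real 4 * pi) / fact 4 * c ^ 4"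
    using Maclaurin_cos_expansion[of c 4] by auto
  then have "cos c = 1 - c\<^sup>2 / 2 + cos (t + 2 * pi) / 24 * c ^ 4"
    unfolding sum4 by (simp add: add.commute fact_numeral)
  moreover have "cos (t + 2 * pi) / 24 * c ^ 4 \<le> 1 / 24 * c ^ 4"
    by (intro mult_right_mono) auto
  moreover have "c ^ 4 \<le> c ^ 2" using that by (intro power_decreasing) auto
  moreover have "0 \<le> c\<^sup>2" by simp
  ultimately show ?thesis by linarith
qed

text \<open>Borel-Cantelli with an explicit summable bound, the form in which both the Rademacher
  detector and the Walsh estimator use it.\<close>

lemma AE_eventually_not:
  assumes "prob_space M" and meas: "\<And>i. {w\<in>space M. P i w} \<in> sets M"
    and le: "\<And>i. emeasure M {w\<in>space M. P i w} \<le> ennreal (b i)" and "summable b"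
    and b: "\<And>i. 0 \<le> b i"
  shows "AE w in M. eventually (\<lambda>i. \<not> P i w) sequentially"
proof -
  interpret prob_space M by fact
  have "measure M {w\<in>space M. P i w} \<le> b i" for i
    using le[of i] b[of i] by (simp add: emeasure_eq_measure)
  then have "summable (\<lambda>i. measure M {w\<in>space M. P i w})"
    by (intro summable_comparison_test'[OF \<open>summable b\<close>, of 0]) auto
  from borel_cantelli_AE1[OF meas _ this]
  have "AE w in M. eventually (\<lambda>i. w \<in> space M - {w\<in>space M. P i w}) sequentially"
    by (simp add: emeasure_eq_measure)
  then show ?thesis by (auto elim!: eventually_mono)
qed

section \<open>Random signs in noise\<close>

context gaussian_noise
begin

lemma prob_UNIV [simp]: "measure G UNIV = 1"
  using prob_space by simp

text \<open>The characteristic function is real: its real part gives the cosine, its imaginary part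
  makes the sine average to zero, and the addition formula brings in the phase
  \<open>a\<close>.\<close>

lemma expectation_cos: "(\<integral>y. cos (a + inner y u) \<partial>G) = cos a * exp (- (norm u)\<^sup>2 / 2)"
proof -
  have int: "complex_integrable G (\<lambda>y. iexp (inner y u))"
    by (intro integrable_const_bound[where B = 1]) auto
  have c: "(\<integral>y. cos (inner y u) \<partial>G) = exp (- (norm u)\<^sup>2 / 2)"
    using integral_Re[OF int] unfolding char by (simp add: Re_exp)
  have s: "(\<integral>y. sin (inner y u) \<partial>G) = 0"
    using integral_Im[OF int] unfolding char by (simp add: Im_exp)
  have [simp]: "integrable G (\<lambda>y. cos (inner y u))" "integrable G (\<lambda>y. sin (inner y u))"
    by (intro integrable_const_bound[where B = 1]; auto)+
  show ?thesis by (simp add: cos_add c s)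
qed

lemma integrable_cos [simp]: "integrable G (\<lambda>y. cos (a + inner y u))"
  by (intro integrable_const_bound[where B = 1]) auto

text \<open>The double-angle formula reduces the square to \<open>expectation_cos\<close> at
  frequencies \<open>u\<close> and \<open>2 *\<^sub>R u\<close>. With q = exp(-|u|^2) the variance
  is exactly (1 - q)(1 - q + 2 q sin(a)^2)/2. The resulting bound is quadratic in \<open>c\<close>
  when |u|^2 and |a| are at most \<open>c\<close>.\<close>

lemma variance_cos:
  assumes "(norm u)\<^sup>2 \<le> 1"
  shows "(\<integral>y. (cos a * exp (- (norm u)\<^sup>2 / 2) - cos (a + inner y u))\<^sup>2 \<partial>G)
    \<le> (norm u)\<^sup>2 * ((norm u)\<^sup>2 + 2 * a\<^sup>2) / 2"
proof -
  define v where "v = (norm u)\<^sup>2"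
  define q where "q = exp (- v)"
  have sq: "(exp (- (v / 2)))\<^sup>2 = q" by (simp add: q_def power2_eq_square exp_add[symmetric])
  have eq: "(cos a * exp (- v / 2) - cos (a + inner y u))\<^sup>2 =
      (cos a)\<^sup>2 * q + 1/2 + (1/2 * cos (2 * a + inner y (2 *\<^sub>R u))
      - 2 * cos a * exp (- v / 2) * cos (a + inner y u))" for y
  proof -
    have "(cos (a + inner y u))\<^sup>2 = 1/2 + 1/2 * cos (2 * a + inner y (2 *\<^sub>R u))"
      using cos_double_cos[of "a + inner y u"] by (simp add: algebra_simps)
    then show ?thesis by (simp add: power2_diff power_mult_distrib sq)
  qed
  have lin: "(\<integral>y. K + (1/2 * F y - d * H y) \<partial>G) = K + (1/2 * (\<integral>y. F y \<partial>G) - d * (\<integral>y. H y \<partial>G))"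
    if "integrable G F" "integrable G H" for K d :: real and F H
    using that by simp
  have "exp (- (norm (2 *\<^sub>R u))\<^sup>2 / 2) = exp (- v) * exp (- v)"
    by (simp add: v_def exp_add[symmetric] power_mult_distrib)
  then have "(\<integral>y. (cos a * exp (- v / 2) - cos (a + inner y u))\<^sup>2 \<partial>G)
      = (cos a)\<^sup>2 * q + 1/2 + (1/2 * (cos (2 * a) * (q * q)) - 2 * cos a * exp (- v / 2) * (cos a * exp (- v / 2)))"
    unfolding eq by (subst lin[OF integrable_cos integrable_cos])
      (simp only: expectation_cos v_def[symmetric] q_def mult.assoc)
  also have "\<dots> = (1 - q) * (1 - q + 2 * (sin a)\<^sup>2 * q) / 2"
  proof -
    have e: "2 * cos a * exp (- v / 2) * (cos a * exp (- v / 2)) = 2 * (cos a)\<^sup>2 * q"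
      by (simp add: sq[symmetric] power2_eq_square)
    have s: "(sin a)\<^sup>2 = 1 - (cos a)\<^sup>2" by (rule sin_squared_eq)
    show ?thesis unfolding e cos_double_cos s by (simp add: field_simps power2_eq_square)
  qed
  also have "\<dots> \<le> v * (v + 2 * a\<^sup>2) / 2"
  proof -
    have "1 - q \<le> v" using exp_ge_add_one_self[of "- v"] by (simp add: q_def)
    moreover have "0 \<le> 1 - q" "0 \<le> q" "q \<le> 1" by (auto simp: q_def v_def)
    moreover have "(sin a)\<^sup>2 \<le> a\<^sup>2" using abs_sin_x_le_abs_x[of a] by (simp add: abs_le_square_iff)
    moreover have "(sin a)\<^sup>2 * q \<le> (sin a)\<^sup>2" by (intro mult_left_le) (auto simp: q_def v_def)
    ultimately have "1 - q + 2 * (sin a)\<^sup>2 * q \<le> v + 2 * a\<^sup>2" "1 - q \<le> v" "0 \<le> q" "0 \<le> 1 - q"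
      by auto
    then show ?thesis by (intro divide_right_mono mult_mono) auto
  qed
  finally show ?thesis by (simp add: v_def)
qed

lemma rademacher_no_detection:
  fixes \<sigma> :: "nat \<Rightarrow> 'a"
  assumes fin: "(\<Sum>n. ennreal (norm (\<sigma> n) ^ 4)) \<noteq> \<infinity>"
  shows "\<not> admits_detection G (rademacher_space \<sigma>)"
proof -
  have sm: "summable (\<lambda>n. norm (\<sigma> n) ^ 4)"
    using fin by (intro summable_suminf_not_top) auto
  define C where "C = exp ((\<Sum>n. norm (\<sigma> n) ^ 4) / 2)"
  define x where "x = (\<lambda>e n. pm (e n) *\<^sub>R \<sigma> n)"
  show ?thesis
  proof (rule no_detection[OF prob_space_coins, where x = x and C = C])
    show "(\<lambda>e. x e n) \<in> borel_measurable coins" for n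
      unfolding x_def by (rule measurable_coins_component)
    show "x e \<in> rademacher_space \<sigma>" for e
      by (auto simp: rademacher_space_def x_def pm_def)
    show "0 < C" by (simp add: C_def)
    fix K
    show "\<exists>k\<ge>K. \<forall>e\<in>space coins.
        (\<integral>\<^sup>+e'. ennreal (exp (\<Sum>n<k. inner (x e n) (x e' n))) \<partial>coins) \<le> ennreal C"
    proof (intro exI[of _ K] conjI ballI)
      fix e :: "nat \<Rightarrow> bool"
      have "(\<integral>\<^sup>+e'. ennreal (exp (\<Sum>n<K. inner (x e n) (x e' n))) \<partial>coins)
          = (\<integral>\<^sup>+e'. (\<Prod>n<K. ennreal (exp (pm (e n) * pm (e' n) * (norm (\<sigma> n))\<^sup>2))) \<partial>coins)"
        by (simp add: exp_sum prod_ennreal x_def power2_norm_eq_inner mult_ac)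
      also have "\<dots> = (\<Prod>n<K. ennreal (exp (pm (e n) * pm True * (norm (\<sigma> n))\<^sup>2)) / 2
          + ennreal (exp (pm (e n) * pm False * (norm (\<sigma> n))\<^sup>2)) / 2)"
        by (rule nn_integral_coins_prod) simp
      \<comment> \<open>Averaging over the sign of \<open>e' n\<close> removes the dependence on
        \<open>e n\<close>, so the bound is uniform in \<open>e\<close>.\<close>
      also have "\<dots> = (\<Prod>n<K. ennreal (cosh ((norm (\<sigma> n))\<^sup>2)))"
        by (intro prod.cong refl)
           (auto simp: pm_def cosh_def ennreal_add_halves add.commute)
      also have "\<dots> = ennreal (\<Prod>n<K. cosh ((norm (\<sigma> n))\<^sup>2))"
        by (intro prod_ennreal) (simp add: cosh_real_nonneg)
      also have "\<dots> \<le> ennreal (\<Prod>n<K. exp (norm (\<sigma> n) ^ 4 / 2))"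
      proof (intro ennreal_leI prod_mono conjI)
        show "cosh ((norm (\<sigma> n))\<^sup>2) \<le> exp (norm (\<sigma> n) ^ 4 / 2)" for n
          using cosh_le_exp_power2[of "(norm (\<sigma> n))\<^sup>2"] by (simp flip: power_mult)
      qed (simp add: cosh_real_nonneg)
      also have "\<dots> = ennreal (exp ((\<Sum>n<K. norm (\<sigma> n) ^ 4) / 2))"
        by (simp add: exp_sum sum_divide_distrib)
      also have "\<dots> \<le> ennreal C"
        unfolding C_def using sm by (intro ennreal_leI) (simp add: sum_le_suminf)
      finally show "(\<integral>\<^sup>+e'. ennreal (exp (\<Sum>n<K. inner (x e n) (x e' n))) \<partial>coins) \<le> ennreal C" .
    qed simp
  qed
qed

lemma UNIV_sets_N [simp]: "UNIV \<in> sets N"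
  using sets.top[of N] by simp

lemma chebyshev_sum:
  fixes h :: "nat \<Rightarrow> 'a \<Rightarrow> real"
  assumes [measurable]: "\<And>n. h n \<in> borel_measurable borel" and bdd: "\<And>n y. \<bar>h n y\<bar> \<le> B"
    and centred: "\<And>n. (\<integral>y. h n y \<partial>G) = 0" and var: "\<And>n. (\<integral>y. (h n y)\<^sup>2 \<partial>G) \<le> b n"
    and "0 < c"
  shows "emeasure N {w. c \<le> \<bar>\<Sum>n<k. h n (w n)\<bar>} \<le> ennreal ((\<Sum>n<k. b n) / c\<^sup>2)"
proof -
  have int: "integrable G (h n)" for n
    using bdd by (intro integrable_const_bound[where B = B]) auto
  have sq: "integrable G (\<lambda>y. (h n y)\<^sup>2)" for n
  proof (intro integrable_const_bound[where B = "B\<^sup>2"] AE_I2)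
    show "norm ((h n y)\<^sup>2) \<le> B\<^sup>2" for y
      using power_mono[OF bdd[of n y], of 2] by simp
  qed auto
  have "c \<le> \<bar>s\<bar> \<longleftrightarrow> 1 \<le> ennreal (1 / c\<^sup>2) * ennreal (s\<^sup>2)" for s
  proof -
    have "c \<le> \<bar>s\<bar> \<longleftrightarrow> c\<^sup>2 \<le> s\<^sup>2" using \<open>0 < c\<close> by (simp add: abs_le_square_iff[symmetric])
    also have "\<dots> \<longleftrightarrow> 1 \<le> ennreal (1 / c\<^sup>2 * s\<^sup>2)" using \<open>0 < c\<close> by (simp add: field_simps)
    finally show ?thesis by (subst ennreal_mult[symmetric]) auto
  qed
  then have "emeasure N {w. c \<le> \<bar>\<Sum>n<k. h n (w n)\<bar>}
      = emeasure N ({w\<in>space N. 1 \<le> ennreal (1 / c\<^sup>2) * ennreal ((\<Sum>n<k. h n (w n))\<^sup>2)} \<inter> space N)"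
    by simp
  also have "\<dots> \<le> ennreal (1 / c\<^sup>2) * (\<integral>\<^sup>+w. ennreal ((\<Sum>n<k. h n (w n))\<^sup>2) * indicator (space N) w \<partial>N)"
    by (rule order_trans[OF _ nn_integral_Markov_inequality]) auto
  also have "\<dots> = ennreal (1 / c\<^sup>2) * ennreal (\<Sum>n<k. \<integral>y. (h n y)\<^sup>2 \<partial>G)"
    using nn_integral_PiM_sum_power2[of "\<lambda>_. G" "{..<k}" h] int sq centred prob_space_axioms by simp
  also have "\<dots> = ennreal ((\<Sum>n<k. \<integral>y. (h n y)\<^sup>2 \<partial>G) / c\<^sup>2)"
    by (subst ennreal_mult[symmetric]) (auto intro!: sum_nonneg)
  also have "\<dots> \<le> ennreal ((\<Sum>n<k. b n) / c\<^sup>2)"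
    by (intro ennreal_leI divide_right_mono sum_mono var) simp
  finally show ?thesis .
qed

text \<open>The statistic \<open>D n\<close> has mean zero under the noise and mean
  \<open>m n\<close> under every signal, whatever its signs, because cosine is even. Its variance is
  at most a constant times \<open>m n\<close>. Once the total mean \<open>M i\<close> is large, a
  threshold at half of it separates the two cases.\<close>

lemma rademacher_detection:
  fixes \<sigma> :: "nat \<Rightarrow> 'a"
  assumes inf: "(\<Sum>n. ennreal (norm (\<sigma> n) ^ 4)) = \<infinity>"
  shows "admits_detection G (rademacher_space \<sigma>)"
proof -
  define s where "s = (\<lambda>n. (norm (\<sigma> n))\<^sup>2)"
  \<comment> \<open>Truncating the frequency keeps the phase \<open>c n\<close> in the unit interval, so that mean and variance
    of the statistic are both of order \<open>(c n)\<^sup>2\<close>, that is, the minimum of 1 and the fourth power.\<close>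
  define c where "c = (\<lambda>n. s n / max 1 (s n))"
  define u where "u = (\<lambda>n. (1 / max 1 (s n)) *\<^sub>R \<sigma> n)"
  define g where "g = (\<lambda>n. exp (- (norm (u n))\<^sup>2 / 2))"
  define m where "m = (\<lambda>n. g n * (1 - cos (c n)))"
  \<comment> \<open>\<open>h a n\<close> is the centred fluctuation when the signal contributes
    phase \<open>a n\<close>: phase 0 is pure noise, and phase \<open>c n\<close> or
    \<open>- c n\<close> is a signal, for which \<open>D n\<close> at the observation equals
    \<open>m n + h a n\<close> at the noise.\<close>
  define h where "h = (\<lambda>a n y. cos (a n) * g n - cos (a n + inner y (u n)))"
  define D where "D = (\<lambda>n y. g n - cos (inner y (u n)))"
  have s0: "0 \<le> s n" for n by (simp add: s_def)
  have c01: "0 \<le> c n" "c n \<le> 1" for n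
    using s0[of n] by (auto simp: c_def max_def)
  have inner_u: "inner (\<sigma> n) (u n) = c n" for n
    by (simp add: u_def c_def s_def power2_norm_eq_inner)
  have nu: "(norm (u n))\<^sup>2 \<le> c n" for n
  proof -
    have "(norm (u n))\<^sup>2 = c n * (1 / max 1 (s n))"
      by (simp add: u_def c_def s_def power_mult_distrib power2_eq_square)
    also have "\<dots> \<le> c n * 1" using c01[of n] by (intro mult_left_mono) auto
    finally show ?thesis by simp
  qed
  have g: "1 / 2 \<le> g n" "g n \<le> 1" for n
  proof -
    have "1 / 2 \<le> 1 + - (norm (u n))\<^sup>2 / 2" using nu[of n] c01[of n] by simp
    also have "\<dots> \<le> g n" unfolding g_def by (rule exp_ge_add_one_self)
    finally show "1 / 2 \<le> g n" .
  qed (simp add: g_def)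
  have m_ge: "(c n)\<^sup>2 / 8 \<le> m n" for n
  proof -
    have "1 / 2 * ((c n)\<^sup>2 / 4) \<le> g n * (1 - cos (c n))"
      using g[of n] one_minus_cos_ge[OF c01] by (intro mult_mono) auto
    then show ?thesis by (simp add: m_def)
  qed
  have m0: "0 \<le> m n" for n using g[of n] by (simp add: m_def)
  \<comment> \<open>If the means were summable, so would be the squares of \<open>c n\<close>. Then
    \<open>c n\<close> eventually drops below 1, the truncation is inactive, and these squares are
    the fourth powers of the norms, contradicting divergence.\<close>
  have unbdd: "\<exists>k. B < (\<Sum>n<k. m n)" for B
  proof (rule ccontr)
    assume "\<not> ?thesis"
    then have "summable m" using m0 by (intro summableI_nonneg_bounded[where x = B]) (auto simp: not_less)
    then have c2: "summable (\<lambda>n. (c n)\<^sup>2)"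
    proof (intro summable_comparison_test'[OF summable_mult, of m 0 "\<lambda>n. (c n)\<^sup>2" 8])
      show "norm ((c n)\<^sup>2) \<le> 8 * m n" for n using m_ge[of n] by simp
    qed
    have "\<forall>\<^sub>F n in sequentially. (c n)\<^sup>2 < 1"
      by (rule order_tendstoD(2)[OF summable_LIMSEQ_zero[OF c2]]) simp
    then have "\<forall>\<^sub>F n in sequentially. norm (\<sigma> n) ^ 4 = (c n)\<^sup>2"
    proof eventually_elim
      case (elim n)
      then have "s n < 1" by (auto simp: c_def max_def split: if_splits)
      then have "c n = s n" by (simp add: c_def max_def)
      then show ?case by (simp add: s_def flip: power_mult)
    qed
    then have "summable (\<lambda>n. norm (\<sigma> n) ^ 4)" using c2 by (simp add: summable_cong)
    then show False using inf by (simp add: suminf_ennreal2)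
  qed
  \<comment> \<open>Choosing blocks whose total mean exceeds \<open>2 ^ i\<close> makes the
    Chebyshev bounds geometric, as Borel-Cantelli requires.\<close>
  have "\<exists>k. 2 ^ i < (\<Sum>n<k. m n)" for i by (rule unbdd)
  then obtain k where k: "\<And>i. 2 ^ i < (\<Sum>n<k i. m n)" by metis
  define M where "M = (\<lambda>i. \<Sum>n<k i. m n)"
  have M: "2 ^ i < M i" for i using k by (simp add: M_def)
  have M0: "0 < M i" for i using M[of i] by (rule less_trans[rotated]) simp
  have dev: "AE w in N. eventually (\<lambda>i. \<not> M i / 2 \<le> \<bar>\<Sum>n<k i. h a n (w n)\<bar>) sequentially"
    if a: "\<And>n. \<bar>a n\<bar> \<le> c n" for a
  proof (rule AE_eventually_not[OF N.prob_space_axioms])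
    have [measurable]: "h a n \<in> borel_measurable borel" for n unfolding h_def by measurable
    show "{w \<in> space N. M i / 2 \<le> \<bar>\<Sum>n<k i. h a n (w n)\<bar>} \<in> N.events" for i by measurable
    have bdd: "\<bar>h a n y\<bar> \<le> 2" for n y
    proof -
      have "\<bar>cos (a n) * g n\<bar> \<le> 1 * 1" unfolding abs_mult using g[of n] by (intro mult_mono) auto
      then show ?thesis unfolding h_def
        using abs_triangle_ineq4[of "cos (a n) * g n" "cos (a n + inner y (u n))"]
          abs_cos_le_one[of "a n + inner y (u n)"] by linarith
    qed
    \<comment> \<open>With |u|^2 and |a| at most \<open>c n\<close>, and \<open>c n\<close> at most
      1, the variance is at most 3/2 times the square of \<open>c n\<close>; \<open>m_ge\<close>
      costs a factor 8, whence 12.\<close>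
    have var: "(\<integral>y. (h a n y)\<^sup>2 \<partial>G) \<le> 12 * m n" for n
    proof -
      have "(\<integral>y. (h a n y)\<^sup>2 \<partial>G) \<le> (norm (u n))\<^sup>2 * ((norm (u n))\<^sup>2 + 2 * (a n)\<^sup>2) / 2"
        unfolding h_def g_def using nu[of n] c01[of n] by (intro variance_cos) auto
      also have "(a n)\<^sup>2 \<le> c n * c n"
        using power_mono[OF a[of n], of 2] by (simp add: power2_eq_square)
      also have "c n * c n \<le> c n * 1" using c01[of n] by (intro mult_left_mono) auto
      finally have "(\<integral>y. (h a n y)\<^sup>2 \<partial>G) \<le> (norm (u n))\<^sup>2 * ((norm (u n))\<^sup>2 + 2 * (c n * 1)) / 2"
        by (simp add: mult_left_mono)
      also have "\<dots> \<le> c n * (c n + 2 * (c n * 1)) / 2"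
        using nu[of n] c01[of n] by (intro divide_right_mono mult_mono add_mono) auto
      finally show ?thesis using m_ge[of n] by (simp add: power2_eq_square)
    qed
    have "emeasure N {w. M i / 2 \<le> \<bar>\<Sum>n<k i. h a n (w n)\<bar>} \<le> ennreal (48 * (1 / 2) ^ i)" for i
    proof -
      have "emeasure N {w. M i / 2 \<le> \<bar>\<Sum>n<k i. h a n (w n)\<bar>}
          \<le> ennreal ((\<Sum>n<k i. 12 * m n) / (M i / 2)\<^sup>2)"
        using M0[of i] bdd var
        by (intro chebyshev_sum[where B = 2]) (auto simp: h_def expectation_cos g_def)
      also have "(\<Sum>n<k i. 12 * m n) = 12 * M i" by (simp add: M_def sum_distrib_left)
      also have "12 * M i / (M i / 2)\<^sup>2 = 48 / M i"
        using M0[of i] by (simp add: power2_eq_square field_simps)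
      also have "ennreal (48 / M i) \<le> ennreal (48 / 2 ^ i)"
        using M[of i] M0[of i] by (intro ennreal_leI divide_left_mono) auto
      also have "48 / 2 ^ i = (48 * (1 / 2) ^ i :: real)" by (simp add: power_one_over)
      finally show ?thesis .
    qed
    then show "emeasure N {w \<in> space N. M i / 2 \<le> \<bar>\<Sum>n<k i. h a n (w n)\<bar>} \<le> ennreal (48 * (1 / 2) ^ i)" for i
      by simp
    show "summable (\<lambda>i. 48 * (1 / 2 :: real) ^ i)" by (rule summable_mult[OF summable_geometric]) simp
  qed simp
  define T where "T = (\<lambda>y. if (\<exists>I. \<forall>i\<ge>I. M i / 2 < (\<Sum>n<k i. D n (y n))) then 1 else 0 :: nat)"
  have [measurable]: "D n \<in> borel_measurable borel" for n unfolding D_def by measurable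
  have "T \<in> N \<rightarrow>\<^sub>M count_space {0, 1}" unfolding T_def by measurable
  then have T: "T \<in> borel \<rightarrow>\<^sub>M count_space {0, 1}" by (simp add: measurable_cong_sets[OF sets_N refl])
  show ?thesis
    unfolding admits_detection_def noise_def
  proof (intro exI[of _ T] conjI ballI T)
    have "D n = h (\<lambda>_. 0) n" for n by (simp add: D_def h_def)
    then have "AE w in N. eventually (\<lambda>i. \<not> M i / 2 \<le> \<bar>\<Sum>n<k i. D n (w n)\<bar>) sequentially"
      using dev[of "\<lambda>_. 0"] c01 by simp
    then show "AE w in N. T w = 0"
    proof eventually_elim
      case (elim w)
      then obtain I where I: "\<And>i. i \<ge> I \<Longrightarrow> \<bar>\<Sum>n<k i. D n (w n)\<bar> < M i / 2"
        by (auto simp: eventually_sequentially not_le)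
      have "\<exists>i\<ge>J. \<not> M i / 2 < (\<Sum>n<k i. D n (w n))" for J
        using I[of "max I J"] by (intro exI[of _ "max I J"]) auto
      then show ?case by (auto simp: T_def)
    qed
  next
    fix x assume x: "x \<in> rademacher_space \<sigma>"
    define a where "a = (\<lambda>n. inner (x n) (u n))"
    have "x n = \<sigma> n \<or> x n = - \<sigma> n" for n using x by (auto simp: rademacher_space_def)
    then have a: "a n = c n \<or> a n = - c n" for n unfolding a_def by (metis inner_u inner_minus_left)
    have "AE w in N. eventually (\<lambda>i. \<not> M i / 2 \<le> \<bar>\<Sum>n<k i. h a n (w n)\<bar>) sequentially"
    proof (rule dev)
      show "\<bar>a n\<bar> \<le> c n" for n using a[of n] c01[of n] by auto
    qed
    then show "AE w in N. T (\<lambda>n. x n + w n) = 1"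
    proof eventually_elim
      case (elim w)
      have "D n (x n + w n) = m n + h a n (w n)" for n
      proof -
        have "cos (a n) = cos (c n)" using a[of n] by auto
        then show ?thesis by (simp add: D_def m_def h_def a_def inner_add_left algebra_simps)
      qed
      then have S: "(\<Sum>n<k i. D n (x n + w n)) = M i + (\<Sum>n<k i. h a n (w n))" for i
        by (simp add: sum.distrib M_def)
      from elim obtain I where "\<And>i. i \<ge> I \<Longrightarrow> \<bar>\<Sum>n<k i. h a n (w n)\<bar> < M i / 2"
        by (auto simp: eventually_sequentially not_le)
      then have "M i / 2 < (\<Sum>n<k i. D n (x n + w n))" if "i \<ge> I" for i
        unfolding S using that by (smt (verit) field_sum_of_halves)
      then show ?case by (auto simp: T_def)
    qed
  qed
qed

lemma rademacher_no_recovery: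
  fixes \<sigma> :: "nat \<Rightarrow> 'a"
  assumes "\<sigma> m \<noteq> 0"
  shows "\<not> admits_recovery G (rademacher_space \<sigma>)"
proof (rule no_recovery[where x = \<sigma> and x' = "\<sigma>(m := - \<sigma> m)" and m = m])
  have "\<sigma> m \<noteq> - \<sigma> m"
  proof
    assume "\<sigma> m = - \<sigma> m"
    then have "\<sigma> m + \<sigma> m = 0" by (metis add.right_inverse)
    then have "2 *\<^sub>R \<sigma> m = 0" by (simp add: scaleR_2)
    then show False using assms by simp
  qed
  then show "\<sigma> m \<noteq> (\<sigma>(m := - \<sigma> m)) m" by simp
qed (auto simp: rademacher_space_def)

end

section \<open>The Walsh space\<close>

text \<open>The Walsh function of index \<open>n\<close> in Paley order, evaluated at the signs
  \<open>r\<close>. It is kept real, so that over either field a signal is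
  \<open>walsh r n *\<^sub>R \<sigma> n\<close>.\<close>

definition walsh :: "(nat \<Rightarrow> real) \<Rightarrow> nat \<Rightarrow> real" where
  "walsh r n = (\<Prod>j | bit n j. r j)"

lemma walsh_signal_of_real:
  "walsh_signal \<sigma> (\<lambda>j. of_real (r j)) n = walsh r n *\<^sub>R \<sigma> n"
  by (simp add: walsh_signal_def walsh_def scaleR_conv_of_real mult.commute)

lemma walsh_mult: "walsh r n * walsh t n = walsh (\<lambda>j. r j * t j) n"
  by (simp add: walsh_def prod.distrib)

text \<open>This and the odd case strip the lowest binary digit of the index, which is the step of
  the induction for \<open>walsh_sum_le\<close>.\<close>

lemma walsh_double: "walsh r (2 * n) = walsh (\<lambda>j. r (Suc j)) n"
proof -
  have "{j. bit (2 * n) j} = Suc ` {j. bit n j}"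
    by (auto simp: bit_double_iff image_iff gr0_conv_Suc)
  then show ?thesis by (simp add: walsh_def prod.reindex)
qed

lemma walsh_Suc_double: "walsh r (Suc (2 * n)) = r 0 * walsh (\<lambda>j. r (Suc j)) n"
proof -
  have "bit (Suc (2 * n)) j \<longleftrightarrow> j = 0 \<or> (\<exists>i. j = Suc i \<and> bit n i)" for j
    by (cases j) (auto simp: bit_Suc bit_0)
  then have "{j. bit (Suc (2 * n)) j} = insert 0 (Suc ` {j. bit n j})" by auto
  then show ?thesis by (simp add: walsh_def prod.reindex finite_bits)
qed

lemma walsh_sign:
  assumes "\<And>i. r i \<in> {-1, 1}"
  shows "walsh r n \<in> {-1, 1}"
proof -
  have "\<bar>r j\<bar> = 1" for j using assms[of j] by auto
  then have "\<bar>walsh r n\<bar> = 1" by (simp add: walsh_def abs_prod)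
  then show ?thesis by auto
qed

lemma bit_less_power: "bit (n::nat) j \<Longrightarrow> n < 2 ^ K \<Longrightarrow> j < K"
  by (metis bit_take_bit_iff take_bit_nat_eq_self)

lemma sum_lessThan_double: "(\<Sum>n<2 * k. f n) = (\<Sum>m<k. f (2 * m) + f (Suc (2 * m)))"
  for f :: "nat \<Rightarrow> 'b::comm_monoid_add"
  by (induction k) (simp_all add: ac_simps)

text \<open>
Grouping the indices $2m$ and $2m+1$ replaces the coefficients by their sums and lowers $j$ by one,
until for $j = 0$ the sums become differences, which telescope by monotonicity.
\<close>

lemma walsh_sum_le:
  fixes s :: "nat \<Rightarrow> real"
  assumes "\<And>i. r i \<in> {-1, 1}" "decseq s" "\<And>n. 0 \<le> s n"
    and "j < K" "r j = -1" "\<And>i. i < j \<Longrightarrow> r i = 1"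
  shows "(\<Sum>n<2 ^ K. s n * walsh r n) \<le> (\<Sum>n<2 ^ j. s n)"
  using assms
proof (induction j arbitrary: s r K)
  case 0
  then obtain K' where K: "K = Suc K'" by (cases K) auto
  let ?r = "\<lambda>j. r (Suc j)"
  have telescope: "(\<Sum>m<k. (s (2 * m) - s (Suc (2 * m))) * 1) \<le> s 0 - s (2 * k)" for k
  proof (induction k)
    case (Suc k)
    then show ?case using decseqD[OF 0(2), of "Suc (2 * k)" "2 * Suc k"] by simp
  qed simp
  have "(\<Sum>n<2 ^ K. s n * walsh r n) = (\<Sum>m<2 ^ K'. (s (2 * m) - s (Suc (2 * m))) * walsh ?r m)"
    using \<open>r 0 = -1\<close> by (simp add: K sum_lessThan_double walsh_double walsh_Suc_double left_diff_distrib)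
  also have "\<dots> \<le> (\<Sum>m<2 ^ K'. (s (2 * m) - s (Suc (2 * m))) * 1)"
  proof (intro sum_mono mult_left_mono)
    show "walsh ?r m \<le> 1" for m using walsh_sign[of ?r m] 0(1) by auto
    show "0 \<le> s (2 * m) - s (Suc (2 * m))" for m using decseqD[OF 0(2)] by simp
  qed
  also have "\<dots> \<le> s 0 - s (2 * 2 ^ K')" by (rule telescope)
  also have "\<dots> \<le> (\<Sum>n<2 ^ 0. s n)" using 0(3) by simp
  finally show ?case .
next
  case (Suc j)
  then obtain K' where K: "K = Suc K'" by (cases K) auto
  let ?r = "\<lambda>j. r (Suc j)" and ?s = "\<lambda>m. s (2 * m) + s (Suc (2 * m))"
  have "r 0 = 1" using Suc.prems by simp
  then have "(\<Sum>n<2 ^ K. s n * walsh r n) = (\<Sum>m<2 ^ K'. ?s m * walsh ?r m)"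
    by (simp add: K sum_lessThan_double walsh_double walsh_Suc_double distrib_right)
  also have "\<dots> \<le> (\<Sum>m<2 ^ j. ?s m)"
  proof (rule Suc.IH)
    show "decseq ?s"
      using decseqD[OF Suc.prems(2)] by (intro decseq_SucI add_mono) simp_all
    show "0 \<le> ?s m" for m using Suc.prems(3) by (simp add: add_nonneg_nonneg)
  qed (use Suc.prems K in auto)
  also have "\<dots> = (\<Sum>n<2 ^ Suc j. s n)" by (simp add: sum_lessThan_double)
  finally show ?case .
qed

text \<open>Let \<open>j\<close> be the first coordinate where \<open>r\<close> is negative, or
  \<open>K\<close> if none occurs below \<open>K\<close>; the term of this \<open>j\<close> already
  dominates. Summing over all candidates gives an expression that can be averaged over
  \<open>r\<close> term by term.\<close>

lemma exp_walsh_sum_le: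
  fixes s :: "nat \<Rightarrow> real"
  assumes r: "\<And>i. r i \<in> {-1, 1}" and s: "decseq s" "\<And>n. 0 \<le> s n"
  shows "exp (\<Sum>n<2 ^ K. s n * walsh r n)
    \<le> (\<Sum>j\<le>K. if \<forall>i<j. r i = 1 then exp (\<Sum>n<2 ^ j. s n) else 0)"
proof -
  have "\<exists>j\<le>K. (\<forall>i<j. r i = 1) \<and> (\<Sum>n<2 ^ K. s n * walsh r n) \<le> (\<Sum>n<2 ^ j. s n)"
  proof (cases "\<forall>i<K. r i = 1")
    case True
    have "s n * walsh r n \<le> s n * 1" for n
      using walsh_sign[of r n] r s(2)[of n] by (intro mult_left_mono) auto
    then have "(\<Sum>n<2 ^ K. s n * walsh r n) \<le> (\<Sum>n<2 ^ K. s n)" by (intro sum_mono) simp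
    then show ?thesis using True by auto
  next
    case False
    then obtain i where i: "i < K" "r i \<noteq> 1" by auto
    define j where "j = (LEAST i. r i \<noteq> 1)"
    have "r j \<noteq> 1" unfolding j_def using i(2) by (rule LeastI)
    moreover have "j \<le> i" unfolding j_def using i(2) by (rule Least_le)
    moreover have "\<forall>i<j. r i = 1" unfolding j_def using not_less_Least by blast
    ultimately show ?thesis
      using walsh_sum_le[OF r s, of j K] r[of j] i by (intro exI[of _ j]) auto
  qed
  then obtain j where j: "j \<le> K" "\<forall>i<j. r i = 1"
    and le: "(\<Sum>n<2 ^ K. s n * walsh r n) \<le> (\<Sum>n<2 ^ j. s n)" by blast
  have "exp (\<Sum>n<2 ^ K. s n * walsh r n) \<le> (if \<forall>i<j. r i = 1 then exp (\<Sum>n<2 ^ j. s n) else 0)"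
    using j le by simp
  also have "\<dots> \<le> (\<Sum>j\<le>K. if \<forall>i<j. r i = 1 then exp (\<Sum>n<2 ^ j. s n) else 0)"
    using j by (intro member_le_sum) auto
  finally show ?thesis .
qed

text \<open>Sign sequences are encoded by the set of their negative positions.\<close>

definition set_sign :: "nat set \<Rightarrow> nat \<Rightarrow> real" where
  "set_sign S j = (if j \<in> S then - 1 else 1)"

text \<open>An index below \<open>2 ^ K\<close> has no bits from position \<open>K\<close> on.
  Observing \<open>2 ^ K\<close> coordinates thus leaves only \<open>2 ^ K\<close> patterns to
  compare.\<close>

lemma walsh_set_sign_restrict:
  assumes "n < 2 ^ K"
  shows "walsh (set_sign (S \<inter> {..<K})) n = walsh (set_sign S) n"
  unfolding walsh_def by (rule prod.cong) (use bit_less_power[OF _ assms] in \<open>auto simp: set_sign_def\<close>)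

section \<open>Walsh signals in noise\<close>

context gaussian_noise
begin

text \<open>Two random signals agree in the first \<open>j\<close> signs with probability 2^(-j),
  while the overlap then contributes \<open>exp (A j)\<close>. The energy bound 1/2 makes this at
  most a constant times q^j, with q the square root of 2, so the series is geometric.\<close>

lemma walsh_no_detection:
  fixes \<sigma> :: "nat \<Rightarrow> 'a"
  assumes dec: "decseq (\<lambda>n. norm (\<sigma> n))" and le: "log_energy \<sigma> < ereal (1 / 2)"
  shows "\<not> admits_detection G (walsh_space \<sigma>)"
proof -
  define s where "s = (\<lambda>n. (norm (\<sigma> n))\<^sup>2)"
  define A where "A = (\<lambda>j. \<Sum>n<2 ^ j. s n)"
  have s: "decseq s" "\<And>n. 0 \<le> s n"
    using dec by (auto simp: s_def decseq_def power_mono)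
  have A_mono: "A i \<le> A j" if "i \<le> j" for i j
    unfolding A_def using that s(2) by (intro sum_mono2) (auto intro: less_le_trans)
  have "\<forall>\<^sub>F k in sequentially. ereal (1 / ln (real k) * (\<Sum>n<k. s n)) < ereal (1 / 2)"
    using Limsup_lessD[OF le[unfolded log_energy_def]] by (simp add: s_def)
  then obtain k0 where k0: "\<And>k. k \<ge> k0 \<Longrightarrow> 1 / ln (real k) * (\<Sum>n<k. s n) < 1 / 2"
    by (auto simp: eventually_sequentially)
  \<comment> \<open>For \<open>j\<close> from here on, both \<open>2 ^ j\<close> exceeds
    \<open>k0\<close> and \<open>j\<close> is at least 1, so that the logarithm of
    \<open>2 ^ j\<close> is positive.\<close>
  define j0 where "j0 = Suc k0"
  define q where "q = exp (ln 2 / 2 :: real)"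
  have q: "0 < q" "q < 2"
  proof -
    have "exp (ln 2 / 2 :: real) < exp (ln 2)" by (subst exp_less_cancel_iff) simp
    then show "q < 2" by (simp add: q_def)
  qed (simp add: q_def)
  \<comment> \<open>The factor \<open>exp (A j0)\<close> pays for the finitely many \<open>j\<close>
    below \<open>j0\<close>, where q^j is at least 1.\<close>
  have expA: "exp (A j) \<le> exp (A j0) * q ^ j" for j
  proof (cases "j \<ge> j0")
    case True
    then have "k0 \<le> 2 ^ j" using less_exp[of j] unfolding j0_def by linarith
    moreover have "1 \<le> j" using True by (simp add: j0_def)
    ultimately have "A j < real j * ln 2 / 2"
      using k0[of "2 ^ j"] by (simp add: A_def ln_realpow field_simps)
    then have "exp (A j) \<le> exp (real j * (ln 2 / 2))" by simp
    also have "\<dots> = 1 * q ^ j" by (simp only: q_def exp_of_nat_mult mult_1)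
    also have "\<dots> \<le> exp (A j0) * q ^ j"
      using q s(2) by (intro mult_right_mono) (auto simp: A_def sum_nonneg)
    finally show ?thesis .
  next
    case False
    then have "exp (A j) * 1 \<le> exp (A j0) * q ^ j"
      using A_mono[of j j0] by (intro mult_mono one_le_power) (auto simp: q_def)
    then show ?thesis by simp
  qed
  define C where "C = exp (A j0) * (1 / (1 - q / 2))"
  define x where "x = (\<lambda>e. walsh_signal \<sigma> (\<lambda>j. of_real (pm (e j)) :: 'a))"
  have x: "x e n = walsh (\<lambda>j. pm (e j)) n *\<^sub>R \<sigma> n" for e n
    unfolding x_def by (rule walsh_signal_of_real)
  show ?thesis
  proof (rule no_detection[OF prob_space_coins, where x = x and C = C])
    show "(\<lambda>e. x e n) \<in> borel_measurable coins" for n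
      unfolding x_def walsh_signal_def by measurable
    show "x e \<in> walsh_space \<sigma>" for e
      unfolding walsh_space_def x_def by (auto simp: pm_def intro!: exI[of _ "\<lambda>j. of_real (pm (e j))"])
    show "0 < C" using q by (simp add: C_def)
    fix K :: nat
    show "\<exists>k\<ge>K. \<forall>e\<in>space coins.
        (\<integral>\<^sup>+e'. ennreal (exp (\<Sum>n<k. inner (x e n) (x e' n))) \<partial>coins) \<le> ennreal C"
    proof (intro exI[of _ "2 ^ K"] conjI ballI)
      fix e :: "nat \<Rightarrow> bool"
      \<comment> \<open>\<open>?f i\<close> indicates that the second signal agrees with
        \<open>e\<close> in sign \<open>i\<close>; a product over \<open>i < j\<close> indicates
        agreement in the first \<open>j\<close> signs.\<close>
      let ?f = "\<lambda>i b. if e i = b then 1 else 0 :: real"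
      have "(\<Sum>n<2 ^ K. inner (x e n) (x e' n)) = (\<Sum>n<2 ^ K. s n * walsh (\<lambda>j. pm (e j) * pm (e' j)) n)" for e'
        by (simp add: x s_def power2_norm_eq_inner walsh_mult[symmetric] mult_ac)
      then have "ennreal (exp (\<Sum>n<2 ^ K. inner (x e n) (x e' n)))
          \<le> (\<Sum>j\<le>K. ennreal (exp (A j)) * (\<Prod>i<j. ennreal (?f i (e' i))))" for e'
      proof -
        have "exp (\<Sum>n<2 ^ K. s n * walsh (\<lambda>j. pm (e j) * pm (e' j)) n)
            \<le> (\<Sum>j\<le>K. if \<forall>i<j. pm (e i) * pm (e' i) = 1 then exp (A j) else 0)"
          unfolding A_def by (rule exp_walsh_sum_le) (use s in \<open>auto simp: pm_def\<close>)
        also have "\<dots> = (\<Sum>j\<le>K. exp (A j) * (\<Prod>i<j. ?f i (e' i)))"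
        proof (intro sum.cong refl)
          show "(if \<forall>i<j. pm (e i) * pm (e' i) = 1 then exp (A j) else 0) = exp (A j) * (\<Prod>i<j. ?f i (e' i))" for j
          proof (cases "\<forall>i<j. e i = e' i")
            case True
            then have "(\<Prod>i<j. ?f i (e' i)) = 1" by (intro prod.neutral) auto
            then show ?thesis using True by (simp add: pm_def)
          next
            case False
            then have "(\<Prod>i<j. ?f i (e' i)) = 0" by (subst prod_zero_iff) auto
            moreover have "\<not> (\<forall>i<j. pm (e i) * pm (e' i) = 1)" using False by (auto simp: pm_def split: if_splits)
            ultimately show ?thesis by (simp only: if_False mult_zero_right)
          qed
        qed
        finally show ?thesis
          using \<open>\<And>e'. (\<Sum>n<2 ^ K. inner (x e n) (x e' n)) = _ e'\<close>
          by (simp add: prod_ennreal ennreal_mult[symmetric] prod_nonneg sum_ennreal ennreal_leI)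
      qed
      then have "(\<integral>\<^sup>+e'. ennreal (exp (\<Sum>n<2 ^ K. inner (x e n) (x e' n))) \<partial>coins)
          \<le> (\<integral>\<^sup>+e'. (\<Sum>j\<le>K. ennreal (exp (A j)) * (\<Prod>i<j. ennreal (?f i (e' i)))) \<partial>coins)"
        by (intro nn_integral_mono)
      also have "\<dots> = (\<Sum>j\<le>K. ennreal (exp (A j)) * (\<integral>\<^sup>+e'. (\<Prod>i<j. ennreal (?f i (e' i))) \<partial>coins))"
        by (simp add: nn_integral_sum nn_integral_cmult)
      also have "\<dots> = (\<Sum>j\<le>K. ennreal (exp (A j)) * ennreal ((1 / 2) ^ j))"
      proof (intro sum.cong refl arg_cong2[where f = "(*)"])
        fix j
        have "(\<integral>\<^sup>+e'. (\<Prod>i<j. ennreal (?f i (e' i))) \<partial>coins)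
            = (\<Prod>i<j. ennreal (?f i True) / 2 + ennreal (?f i False) / 2)"
          by (rule nn_integral_coins_prod) simp
        also have "\<dots> = (\<Prod>i<j. ennreal (1 / 2))"
          by (intro prod.cong refl) (subst ennreal_add_halves, auto)
        also have "\<dots> = ennreal ((1 / 2) ^ j)"
          unfolding prod_constant card_lessThan by (rule ennreal_power) simp
        finally show "(\<integral>\<^sup>+e'. (\<Prod>i<j. ennreal (?f i (e' i))) \<partial>coins) = ennreal ((1 / 2) ^ j)" .
      qed
      also have "\<dots> = ennreal (\<Sum>j\<le>K. exp (A j) * (1 / 2) ^ j)"
        by (simp add: ennreal_mult[symmetric] sum_ennreal)
      also have "\<dots> \<le> ennreal C"
      proof (rule ennreal_leI)
        have "(\<Sum>j\<le>K. exp (A j) * (1 / 2) ^ j) \<le> (\<Sum>j\<le>K. exp (A j0) * q ^ j * (1 / 2) ^ j)"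
          by (intro sum_mono mult_right_mono expA) simp
        also have "\<dots> = exp (A j0) * (\<Sum>j\<le>K. (q / 2) ^ j)"
          by (simp add: sum_distrib_left power_divide mult.assoc)
        also have "(\<Sum>j\<le>K. (q / 2) ^ j) \<le> (\<Sum>j. (q / 2) ^ j)"
          using q by (intro sum_le_suminf summable_geometric) auto
        also have "(\<Sum>j. (q / 2) ^ j) = 1 / (1 - q / 2)"
          using q by (intro suminf_geometric) auto
        finally show "(\<Sum>j\<le>K. exp (A j) * (1 / 2) ^ j) \<le> C" by (simp add: C_def)
      qed
      finally show "(\<integral>\<^sup>+e'. ennreal (exp (\<Sum>n<2 ^ K. inner (x e n) (x e' n))) \<partial>coins) \<le> ennreal C" .
    qed (use less_exp[of K] in simp)
  qed
qed

text \<open>Exponential Markov inequality with parameter 1/2, the optimal one for a centred Gaussian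
  of variance D exceeding D/2: the exponent is -D/4 + D/8.\<close>

lemma chernoff:
  "emeasure N {w. (\<Sum>n<k. (norm (d n))\<^sup>2) / 2 \<le> (\<Sum>n<k. inner (w n) (d n))}
    \<le> ennreal (exp (- (\<Sum>n<k. (norm (d n))\<^sup>2) / 8))"
proof -
  let ?D = "\<Sum>n<k. (norm (d n))\<^sup>2"
  have "?D / 2 \<le> t \<longleftrightarrow> 1 \<le> ennreal (exp (- ?D / 4)) * ennreal (exp (t / 2))" for t
    by (subst ennreal_mult[symmetric]) (auto simp: exp_add[symmetric])
  then have "emeasure N {w. ?D / 2 \<le> (\<Sum>n<k. inner (w n) (d n))}
      = emeasure N ({w\<in>space N. 1 \<le> ennreal (exp (- ?D / 4)) * ennreal (exp ((\<Sum>n<k. inner (w n) (d n)) / 2))} \<inter> space N)"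
    by simp
  also have "\<dots> \<le> ennreal (exp (- ?D / 4)) *
      (\<integral>\<^sup>+w. ennreal (exp ((\<Sum>n<k. inner (w n) (d n)) / 2)) * indicator (space N) w \<partial>N)"
    by (rule order_trans[OF _ nn_integral_Markov_inequality]) auto
  also have "\<dots> = ennreal (exp (- ?D / 4)) * (\<integral>\<^sup>+w. (\<Prod>n<k. ennreal (exp (inner (w n) ((1/2) *\<^sub>R d n)))) \<partial>N)"
    by (simp add: prod_ennreal exp_sum[symmetric] sum_divide_distrib)
  also have "\<dots> = ennreal (exp (- ?D / 4)) * (\<Prod>n<k. ennreal (exp ((norm ((1/2) *\<^sub>R d n))\<^sup>2 / 2)))"
    by (subst nn_integral_PiM_prod[OF prob_space_axioms]) (simp_all only: mgf finite_lessThan, simp)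
  also have "\<dots> = ennreal (exp (- ?D / 4) * exp (?D / 8))"
    by (simp add: prod_ennreal exp_sum[symmetric] power_mult_distrib power_divide
        sum_divide_distrib ennreal_mult)
  also have "exp (- ?D / 4) * exp (?D / 8) = exp (- ?D / 8)" by (simp add: exp_add[symmetric])
  finally show ?thesis .
qed

text \<open>Each wrong pattern beats the truth with probability at most
  \<open>exp ((A j - A K) / 4)\<close>. The energy bound 8 turns this into a multiple of 4^(-K),
  which beats the union bound over \<open>2 ^ K\<close> patterns. The coordinate \<open>j\<close> is
  fixed throughout, so \<open>A j\<close> is a constant.\<close>

lemma walsh_recovery:
  fixes \<sigma> :: "nat \<Rightarrow> 'a"
  assumes dec: "decseq (\<lambda>n. norm (\<sigma> n))" and gt: "ereal 8 < log_energy \<sigma>"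
  shows "admits_recovery G (walsh_space \<sigma>)"
proof -
  define s where "s = (\<lambda>n. (norm (\<sigma> n))\<^sup>2)"
  define A where "A = (\<lambda>j. \<Sum>n<2 ^ j. s n)"
  have s: "decseq s" "\<And>n. 0 \<le> s n"
    using dec by (auto simp: s_def decseq_def power_mono)
  have A_mono: "A i \<le> A j" if "i \<le> j" for i j
    unfolding A_def using that s(2) by (intro sum_mono2) (auto intro: less_le_trans)
  \<comment> \<open>This passes from arbitrary \<open>k\<close> to powers of two. With
    \<open>K\<close> minimal such that \<open>k\<close> is at most \<open>2 ^ K\<close>, the
    logarithm of \<open>k\<close> is at least that of \<open>2 ^ (K - 1)\<close>, which costs the
    \<open>- 1\<close>.\<close>
  have "\<exists>K\<ge>L. 8 * (real K - 1) * ln 2 \<le> A K" for L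
  proof -
    have "\<exists>k\<ge>2 ^ Suc L. 8 < 1 / ln (real k) * (\<Sum>n<k. s n)"
    proof (rule ccontr)
      assume "\<not> ?thesis"
      then have "\<forall>\<^sub>F k in sequentially. ereal (1 / ln (real k) * (\<Sum>n<k. s n)) \<le> ereal 8"
        by (auto simp: eventually_sequentially not_less intro!: exI[of _ "2 ^ Suc L"])
      then have "log_energy \<sigma> \<le> ereal 8"
        unfolding log_energy_def s_def by (rule Limsup_bounded)
      then show False using gt by simp
    qed
    then obtain k where k: "2 ^ Suc L \<le> k" "8 < 1 / ln (real k) * (\<Sum>n<k. s n)" by blast
    have "2 \<le> k" using k(1) self_le_power[of "2::nat" "Suc L"] by linarith
    define K where "K = (LEAST K. k \<le> 2 ^ K)"
    have kK: "k \<le> 2 ^ K"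
      unfolding K_def using less_exp[of k] by (intro LeastI[of "\<lambda>K. k \<le> 2 ^ K" k]) simp
    have "(2::nat) ^ Suc L \<le> 2 ^ K" using k(1) kK by (rule order_trans)
    then have "Suc L \<le> K" by (simp add: power_increasing_iff del: power_Suc)
    then obtain K' where K': "K = Suc K'" "L \<le> K'" by (cases K) auto
    then have "\<not> k \<le> 2 ^ K'" using not_less_Least[of K' "\<lambda>K. k \<le> 2 ^ K"] by (simp add: K_def)
    then have "real 2 ^ K' \<le> real k" by (metis nle_le of_nat_mono of_nat_power)
    then have "ln (2 ^ K') \<le> ln (real k)" using \<open>2 \<le> k\<close> by simp
    then have "8 * (real K' * ln 2) \<le> 8 * ln (real k)" by (simp add: ln_realpow)
    also have "\<dots> \<le> (\<Sum>n<k. s n)" using k(2) \<open>2 \<le> k\<close> by (simp add: field_simps)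
    also have "\<dots> \<le> A K" unfolding A_def using kK s(2) by (intro sum_mono2) auto
    finally show ?thesis using K' by (intro exI[of _ K]) (simp add: mult.assoc)
  qed
  then obtain K where K: "\<And>i. i \<le> K i" "\<And>i. 8 * (real (K i) - 1) * ln 2 \<le> A (K i)" by metis
  \<comment> \<open>The log-likelihood of pattern \<open>S\<close> up to terms free of
    \<open>S\<close>, since all patterns give signals of equal norm in each coordinate.\<close>
  define l where "l = (\<lambda>i S y. \<Sum>n<2 ^ K i. inner (y n) (walsh (set_sign S) n *\<^sub>R \<sigma> n))"
  have l_restrict: "l i (S \<inter> {..<K i}) y = l i S y" for i S y
    unfolding l_def by (intro sum.cong refl) (simp add: walsh_set_sign_restrict)
  have l_meas [measurable]: "l i S \<in> borel_measurable N" for i S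
    unfolding l_def by measurable
  have [measurable]: "(\<lambda>w. l i S (\<lambda>n. x n + w n)) \<in> borel_measurable N" for i S x
    unfolding l_def by measurable
  define x where "x = (\<lambda>S n. walsh (set_sign S) n *\<^sub>R \<sigma> n)"
  \<comment> \<open>The bad event for coordinate \<open>j\<close>: some pattern with the wrong sign
    there is at least as likely as the truth. Competitors that agree with the truth at
    \<open>j\<close> do no harm.\<close>
  define err where "err = (\<lambda>j S i w. j < K i \<and> (\<exists>S'\<in>Pow {..<K i}. (j \<in> S') \<noteq> (j \<in> S) \<and>
    l i S (\<lambda>n. x S n + w n) \<le> l i S' (\<lambda>n. x S n + w n)))"
  \<comment> \<open>With \<open>d\<close> the difference of the signals and D its squared norm, the
    competitor wins exactly when the noise correlates with \<open>d\<close> by at least D/2, which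
    \<open>chernoff\<close> bounds. The Walsh sum estimate gives D at least
    \<open>2 * (A (K i) - A j)\<close>.\<close>
  have pair: "emeasure N {w. l i S (\<lambda>n. x S n + w n) \<le> l i S' (\<lambda>n. x S n + w n)}
      \<le> ennreal (exp ((A j - A (K i)) / 4))"
    if j: "j < K i" "(j \<in> S') \<noteq> (j \<in> S)" for i j S S'
  proof -
    define d where "d = (\<lambda>n. (walsh (set_sign S') n - walsh (set_sign S) n) *\<^sub>R \<sigma> n)"
    define r where "r = (\<lambda>j. set_sign S j * set_sign S' j)"
    define D where "D = (\<Sum>n<2 ^ K i. (norm (d n))\<^sup>2)"
    have sgn: "set_sign S j \<in> {-1, 1}" for S j by (simp add: set_sign_def)
    have r: "r j \<in> {-1, 1}" for j by (simp add: r_def set_sign_def)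
    have d2: "(norm (d n))\<^sup>2 = 2 * (s n - s n * walsh r n)"
      and xd: "inner (x S n) (d n) = - ((norm (d n))\<^sup>2 / 2)" for n
    proof -
      have w: "walsh (set_sign S) n \<in> {-1, 1}" "walsh (set_sign S') n \<in> {-1, 1}"
        by (rule walsh_sign[OF sgn])+
      have wr: "walsh r n = walsh (set_sign S) n * walsh (set_sign S') n"
        unfolding r_def by (rule walsh_mult[symmetric])
      show d2: "(norm (d n))\<^sup>2 = 2 * (s n - s n * walsh r n)"
        using w by (auto simp: d_def s_def wr power_mult_distrib)
      show "inner (x S n) (d n) = - ((norm (d n))\<^sup>2 / 2)"
        unfolding d2 using w by (auto simp: x_def d_def s_def wr power2_norm_eq_inner)
    qed
    have diff: "l i S' (\<lambda>n. x S n + w n) - l i S (\<lambda>n. x S n + w n)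
        = (\<Sum>n<2 ^ K i. inner (w n) (d n)) - D / 2" for w
    proof -
      have "l i S' (\<lambda>n. x S n + w n) - l i S (\<lambda>n. x S n + w n)
          = (\<Sum>n<2 ^ K i. inner (x S n + w n) (d n))"
        by (simp only: l_def d_def sum_subtractf[symmetric] inner_diff_right[symmetric] scaleR_left_diff_distrib)
      also have "\<dots> = (\<Sum>n<2 ^ K i. inner (w n) (d n)) - D / 2"
        by (simp add: inner_add_left xd sum.distrib sum_subtractf sum_negf D_def sum_divide_distrib)
      finally show ?thesis .
    qed
    have "l i S (\<lambda>n. x S n + w n) \<le> l i S' (\<lambda>n. x S n + w n) \<longleftrightarrow> D / 2 \<le> (\<Sum>n<2 ^ K i. inner (w n) (d n))" for w
      using diff[of w] by linarith
    then have "emeasure N {w. l i S (\<lambda>n. x S n + w n) \<le> l i S' (\<lambda>n. x S n + w n)}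
        \<le> ennreal (exp (- D / 8))"
      unfolding D_def using chernoff[where k = "2 ^ K i" and d = d] by simp
    also have "D = 2 * (A (K i) - (\<Sum>n<2 ^ K i. s n * walsh r n))"
      by (simp add: D_def d2 A_def sum_subtractf sum_distrib_left[symmetric])
    also have "(\<Sum>n<2 ^ K i. s n * walsh r n) \<le> A j"
    proof -
      have "r j = -1" using j(2) by (auto simp: r_def set_sign_def)
      \<comment> \<open>The Walsh bound refers to the first disagreement, which may come before
        \<open>j\<close>; monotonicity of \<open>A\<close> restores the uniform bound
        \<open>A j\<close>.\<close>
      define m where "m = (LEAST i. r i = -1)"
      have "r m = -1" unfolding m_def using \<open>r j = -1\<close> by (rule LeastI)
      moreover have "m \<le> j" unfolding m_def using \<open>r j = -1\<close> by (rule Least_le)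
      moreover have "r i = 1" if "i < m" for i
        using not_less_Least[OF that[unfolded m_def]] r[of i] by auto
      ultimately have "(\<Sum>n<2 ^ K i. s n * walsh r n) \<le> A m"
        unfolding A_def using j by (intro walsh_sum_le r s) auto
      also have "\<dots> \<le> A j" using \<open>m \<le> j\<close> by (rule A_mono)
      finally show ?thesis .
    qed
    finally show ?thesis by (simp add: diff_divide_distrib)
  qed
  have err_le: "emeasure N {w. err j S i w} \<le> ennreal (4 * exp (A j / 4) * (1 / 2) ^ i)" for j S i
  proof (cases "j < K i")
    case True
    let ?F = "{S'\<in>Pow {..<K i}. (j \<in> S') \<noteq> (j \<in> S)}"
    have fin: "finite ?F" by simp
    have "card ?F \<le> card (Pow {..<K i})" by (intro card_mono) auto
    then have card: "card ?F \<le> 2 ^ K i" by (simp add: card_Pow)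
    have "{w. err j S i w} = (\<Union>S'\<in>?F. {w. l i S (\<lambda>n. x S n + w n) \<le> l i S' (\<lambda>n. x S n + w n)})"
      using True by (auto simp: err_def)
    also have "emeasure N \<dots> \<le> (\<Sum>S'\<in>?F. emeasure N {w. l i S (\<lambda>n. x S n + w n) \<le> l i S' (\<lambda>n. x S n + w n)})"
    proof (rule emeasure_subadditive_finite[OF fin])
      have "{w\<in>space N. l i S (\<lambda>n. x S n + w n) \<le> l i S' (\<lambda>n. x S n + w n)} \<in> sets N" for S' by measurable
      then show "(\<lambda>S'. {w. l i S (\<lambda>n. x S n + w n) \<le> l i S' (\<lambda>n. x S n + w n)}) ` ?F \<subseteq> sets N" by auto
    qed
    also have "\<dots> \<le> (\<Sum>S'\<in>?F. ennreal (exp ((A j - A (K i)) / 4)))"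
      using True by (intro sum_mono pair) auto
    also have "\<dots> = ennreal (real (card ?F) * exp ((A j - A (K i)) / 4))"
      by (simp add: ennreal_mult ennreal_of_nat_eq_real_of_nat)
    also have "\<dots> \<le> ennreal (4 * exp (A j / 4) * (1 / 2) ^ i)"
    proof (rule ennreal_leI)
      have e2: "exp (2 * ln 2) = (4::real)" using exp_of_nat_mult[of 2 "ln 2 :: real"] by simp
      then have e2': "exp (- 2 * ln 2) = (1 / 4 :: real)" using exp_minus[of "2 * ln 2 :: real"] by simp
      \<comment> \<open>A quarter of the lower bound for \<open>A (K i)\<close> is
        \<open>2 * (K i - 1) * ln 2\<close>, so the exponential yields 4^(-K) times 4.\<close>
      have "exp ((A j - A (K i)) / 4) \<le> exp (A j / 4 + (real (K i) * (- 2 * ln 2) + 2 * ln 2))"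
        using K(2)[of i] by (subst exp_le_cancel_iff) (simp add: field_simps)
      also have "\<dots> = exp (A j / 4) * (exp (- 2 * ln 2) ^ K i * exp (2 * ln 2))"
        by (simp only: exp_add exp_of_nat_mult)
      also note e2
      also note e2'
      finally have "real (card ?F) * exp ((A j - A (K i)) / 4) \<le> 2 ^ K i * (exp (A j / 4) * ((1 / 4) ^ K i * 4))"
        using card by (intro mult_mono) (auto simp: of_nat_le_numeral_power_cancel_iff)
      also have "\<dots> = 4 * exp (A j / 4) * (2 ^ K i * (1 / 4) ^ K i)" by simp
      also have "2 ^ K i * (1 / 4) ^ K i = (1 / 2 :: real) ^ K i" by (simp flip: power_mult_distrib)
      also have "4 * exp (A j / 4) * (1 / 2) ^ K i \<le> 4 * exp (A j / 4) * (1 / 2) ^ i"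
        using K(1) by (intro mult_left_mono power_decreasing) auto
      finally show "real (card ?F) * exp ((A j - A (K i)) / 4) \<le> 4 * exp (A j / 4) * (1 / 2) ^ i" .
    qed
    finally show ?thesis .
  qed (simp add: err_def)
  have no_err: "AE w in N. eventually (\<lambda>i. \<not> err j S i w) sequentially" for j S
  proof (rule AE_eventually_not[OF N.prob_space_axioms])
    show "{w \<in> space N. err j S i w} \<in> N.events" for i
    proof -
      have "Measurable.pred N (\<lambda>w. l i S (\<lambda>n. x S n + w n) \<le> l i S' (\<lambda>n. x S n + w n))" for S'
        unfolding pred_def by measurable
      then have "Measurable.pred N (err j S i)"
        unfolding err_def by (intro pred_intros_logic(3) pred_intros_finite(4)) auto
      then show ?thesis by (simp add: pred_def)
    qed
    show "emeasure N {w \<in> space N. err j S i w} \<le> ennreal (4 * exp (A j / 4) * (1 / 2) ^ i)" for i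
      using err_le by simp
    show "summable (\<lambda>i. 4 * exp (A j / 4) * (1 / 2) ^ i)" by (rule summable_mult[OF summable_geometric]) simp
  qed simp
  \<comment> \<open>The maximum likelihood decision on coordinate \<open>j\<close> among the patterns in the first \<open>K i\<close> bits\<close>
  define est where "est = (\<lambda>i j y. \<exists>S'\<in>Pow {..<K i}. j \<in> S' \<and>
    (\<forall>S''\<in>Pow {..<K i}. j \<notin> S'' \<longrightarrow> l i S'' y < l i S' y))"
  have est: "est i j (\<lambda>n. x S n + w n) \<longleftrightarrow> j \<in> S" if "\<not> err j S i w" "j < K i" for i j S w
  proof
    assume "j \<in> S"
    \<comment> \<open>The witness is the true pattern cut down to its first \<open>K i\<close>
      signs, which has the same likelihood by \<open>l_restrict\<close>.\<close>
    then show "est i j (\<lambda>n. x S n + w n)"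
      using that unfolding est_def err_def
      by (intro bexI[of _ "S \<inter> {..<K i}"]) (auto simp: l_restrict not_le)
  next
    assume "est i j (\<lambda>n. x S n + w n)"
    then obtain S' where S': "S' \<in> Pow {..<K i}" "j \<in> S'"
      and max: "\<And>S''. S'' \<in> Pow {..<K i} \<Longrightarrow> j \<notin> S'' \<Longrightarrow> l i S'' (\<lambda>n. x S n + w n) < l i S' (\<lambda>n. x S n + w n)"
      unfolding est_def by blast
    show "j \<in> S"
    proof (rule ccontr)
      assume "j \<notin> S"
      then have "l i S (\<lambda>n. x S n + w n) < l i S' (\<lambda>n. x S n + w n)"
        using max[of "S \<inter> {..<K i}"] by (simp add: l_restrict)
      then show False using that S' \<open>j \<notin> S\<close> unfolding err_def by auto
    qed
  qed
  \<comment> \<open>A sign is declared negative when the decisions for it are eventually all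
    negative, and positive otherwise; each sign is settled by its own tail of blocks.\<close>
  define T where "T = (\<lambda>y. walsh_signal \<sigma> (\<lambda>j. of_real (if \<exists>I. \<forall>i\<ge>I. est i j y then - 1 else 1)))"
  have [measurable]: "Measurable.pred N (est i j)" for i j
  proof -
    have "Measurable.pred N (\<lambda>y. l i S'' y < l i S' y)" for S' S''
      unfolding pred_def by measurable
    then show ?thesis
      unfolding est_def
      by (intro pred_intros_finite(3,4) pred_intros_logic(3,4)) auto
  qed
  have "T \<in> borel_measurable N"
    unfolding T_def walsh_signal_def
    by (rule measurable_coordinatewise_then_product) measurable
  then have T: "T \<in> borel_measurable borel" by (simp add: measurable_cong_sets[OF sets_N refl])
  show ?thesis
    unfolding admits_recovery_def noise_def
  proof (intro exI[of _ T] conjI ballI T)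
    fix z assume "z \<in> walsh_space \<sigma>"
    then obtain \<epsilon> where z: "z = walsh_signal \<sigma> \<epsilon>" and \<epsilon>: "\<And>j. \<epsilon> j \<in> {-1, 1}"
      by (auto simp: walsh_space_def)
    define S where "S = {j. \<epsilon> j = - 1}"
    have \<epsilon>_eq: "\<epsilon> = (\<lambda>j. of_real (set_sign S j))"
      using \<epsilon> by (auto simp: S_def set_sign_def fun_eq_iff)
    have xz: "z = x S"
      unfolding z \<epsilon>_eq x_def by (auto simp: walsh_signal_of_real)
    have "AE w in N. \<forall>j. eventually (\<lambda>i. \<not> err j S i w) sequentially"
      by (simp add: AE_all_countable no_err)
    then show "AE w in N. T (\<lambda>n. z n + w n) = z"
    proof eventually_elim
      case (elim w)
      have "(\<exists>I. \<forall>i\<ge>I. est i j (\<lambda>n. x S n + w n)) \<longleftrightarrow> j \<in> S" for j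
      proof -
        have "\<forall>\<^sub>F i in sequentially. j < K i"
          using eventually_gt_at_top[of j] by eventually_elim (rule less_le_trans[OF _ K(1)])
        then have "\<forall>\<^sub>F i in sequentially. est i j (\<lambda>n. x S n + w n) \<longleftrightarrow> j \<in> S"
          using elim[rule_format, of j] by eventually_elim (rule est)
        then have "(\<forall>\<^sub>F i in sequentially. est i j (\<lambda>n. x S n + w n)) \<longleftrightarrow> j \<in> S"
          by (subst eventually_subst) auto
        then show ?thesis by (simp add: eventually_sequentially)
      qed
      then have "T (\<lambda>n. x S n + w n) = walsh_signal \<sigma> (\<lambda>j. of_real (set_sign S j))"
        unfolding T_def set_sign_def by simp
      also have "\<dots> = z" by (simp only: z \<epsilon>_eq)
      finally show ?case by (simp only: xz)
    qed
  qed
qed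

end

section \<open>Both fields, with thresholds 1/2 and 8\<close>

theorem theorem6p1:
  shows
    "(\<forall>\<sigma> :: nat \<Rightarrow> real.
        (admits_detection std_gaussian_real (rademacher_space \<sigma>) \<longleftrightarrow>
           (\<Sum>n. ennreal (norm (\<sigma> n) ^ 4)) = \<infinity>) \<and>
        (\<not> (\<forall>n. \<sigma> n = 0) \<longrightarrow>
           \<not> admits_recovery std_gaussian_real (rademacher_space \<sigma>))) \<and>
     (\<forall>\<sigma> :: nat \<Rightarrow> complex.
        (admits_detection std_gaussian_complex (rademacher_space \<sigma>) \<longleftrightarrow>
           (\<Sum>n. ennreal (norm (\<sigma> n) ^ 4)) = \<infinity>) \<and>
        (\<not> (\<forall>n. \<sigma> n = 0) \<longrightarrow>
           \<not> admits_recovery std_gaussian_complex (rademacher_space \<sigma>))) \<and>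
     (\<exists>a b :: real. 0 < a \<and> a < b \<and>
        (\<forall>\<sigma> :: nat \<Rightarrow> real. decseq (\<lambda>n. norm (\<sigma> n)) \<longrightarrow>
           (log_energy \<sigma> > ereal b \<longrightarrow>
              admits_recovery std_gaussian_real (walsh_space \<sigma>)) \<and>
           (log_energy \<sigma> < ereal a \<longrightarrow>
              \<not> admits_detection std_gaussian_real (walsh_space \<sigma>))) \<and>
        (\<forall>\<sigma> :: nat \<Rightarrow> complex. decseq (\<lambda>n. norm (\<sigma> n)) \<longrightarrow>
           (log_energy \<sigma> > ereal b \<longrightarrow>
              admits_recovery std_gaussian_complex (walsh_space \<sigma>)) \<and>
           (log_energy \<sigma> < ereal a \<longrightarrow>
              \<not> admits_detection std_gaussian_complex (walsh_space \<sigma>))))"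
proof -
  interpret R: gaussian_noise std_gaussian_real by (rule gaussian_noise_real)
  interpret C: gaussian_noise std_gaussian_complex by (rule gaussian_noise_complex)
  show ?thesis
  proof (intro conjI allI;
      (rule exI[of _ "1/2"], rule exI[of _ 8], intro conjI allI impI)?)
    show "admits_detection std_gaussian_real (rademacher_space \<sigma>) \<longleftrightarrow>
        (\<Sum>n. ennreal (norm (\<sigma> n) ^ 4)) = \<infinity>" for \<sigma> :: "nat \<Rightarrow> real"
      using R.rademacher_detection R.rademacher_no_detection by blast
    show "admits_detection std_gaussian_complex (rademacher_space \<sigma>) \<longleftrightarrow>
        (\<Sum>n. ennreal (norm (\<sigma> n) ^ 4)) = \<infinity>" for \<sigma> :: "nat \<Rightarrow> complex"
      using C.rademacher_detection C.rademacher_no_detection by blast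
  qed (use R.rademacher_no_recovery C.rademacher_no_recovery R.walsh_recovery C.walsh_recovery
      R.walsh_no_detection C.walsh_no_detection in auto)
qed

end
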